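(* Let $\mathcal{M}$ be a model category with initial object $0$, and let $\{\phi_i: A_i \to B_i\}_{i\in I}$ be a set of cofibrations of $\mathcal{M}$ such that (1) the class of retracts of relative $I$-cell complexes coincides with the class of cofibrations of $\mathcal{M}$, and (2) there is a regular ordinal $\lambda$ such that each $A_i$ is $\lambda$-small relative to the subcategory of cofibrations of $\mathcal{M}$. Let $(S,\epsilon)$, $\epsilon_X: SX \to X$, be the cofibrant-replacement functor constructed from $\{\phi_i\}_{i\in I}$ and $\lambda$ by the small object argument. Then there is a natural transformation $\Delta: S \to S^2$ such that $(S,\epsilon,\Delta)$ is a cotriple on $\mathcal{M}$, i.e. $\epsilon S\circ\Delta = \mathrm{id}_S$, $S\epsilon\circ\Delta=\mathrm{id}_S$ and $S\Delta\circ\Delta=\Delta S\circ\Delta$.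
   Context: A cotriple is a comonad. Relative $I$-cell complexes are transfinite compositions of pushouts of elements of $\{\phi_i\}_{i\in I}$. The small object argument functor $(S,\epsilon)$ is the following. For an object $X$, define by transfinite induction objects $S_\beta X$ with maps $\epsilon_\beta: S_\beta X\to X$. Put $S_0X=0$. If $\beta$ is a limit ordinal, $S_\beta X=\operatorname{colim}_{\beta'<\beta}S_{\beta'}X$ and $\epsilon_\beta=\operatorname{colim}_{\beta'<\beta}\epsilon_{\beta'}$. At successors, $S_{\beta+1}X$ is the pushout of $$\coprod_{D_\beta(X)} B_i \xleftarrow{\ \coprod\phi_i\ } \coprod_{D_\beta(X)} A_i \to S_\beta X,$$ where $D_\beta(X)$ is the set of all commutative squares consisting of $\phi_i: A_i\to B_i$, a map $A_i\to S_\beta X$, a map $B_i\to X$, and $\epsilon_\beta: S_\beta X\to X$ (over all $i\in I$); the map $\epsilon_{\beta+1}: S_{\beta+1}X\to X$ is induced by $\epsilon_\beta$ and the given maps $B_i\to X$. Finally $SX=\operatorname{colim}_{\beta<\lambda}S_\beta X$ and $\epsilon=\operatorname{colim}_{\beta<\lambda}\epsilon_\beta$. This is functorial in $X$ in the evident way, $SX$ is cofibrant and $\epsilon$ is a natural acyclic fibration. *)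

theory Defs
  imports Main
begin

unbundle cardinal_syntax

text \<open>
  Size conventions.  The type \<open>'u\<close> plays the role of the universe, represented by the cardinal
  \<open>|UNIV :: 'u set|\<close>: a set is small iff it has fewer elements than \<open>'u\<close>.  A Grothendieck
  universe corresponds to an inaccessible cardinal.  Only the infiniteness and regularity of that
  cardinal are demanded here, which is more general.
\<close>

definition universe :: "'u itself \<Rightarrow> bool" where
  "universe U \<longleftrightarrow> infinite (UNIV :: 'u set) \<and> regularCard |UNIV :: 'u set|"

definition small :: "'u itself \<Rightarrow> 'a set \<Rightarrow> bool" where
  "small U A \<longleftrightarrow> |A| <o |UNIV :: 'u set|"


section \<open>Categories\<close>

record ('o, 'm) cat =
  Obj :: "'o set"
  Arr :: "'m set"
  Dom :: "'m \<Rightarrow> 'o"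
  Cod :: "'m \<Rightarrow> 'o"
  Ide :: "'o \<Rightarrow> 'm"
  Comp :: "'m \<Rightarrow> 'm \<Rightarrow> 'm"  (infixl "\<cdot>\<index>" 70)

definition homs :: "('o, 'm) cat \<Rightarrow> 'o \<Rightarrow> 'o \<Rightarrow> 'm set" where
  "homs C X Y = {f \<in> Arr C. Dom C f = X \<and> Cod C f = Y}"

definition category :: "('o, 'm) cat \<Rightarrow> bool" where
  "category C \<longleftrightarrow>
     (\<forall>f \<in> Arr C. Dom C f \<in> Obj C \<and> Cod C f \<in> Obj C) \<and>
     (\<forall>X \<in> Obj C. Ide C X \<in> homs C X X) \<and>
     (\<forall>X Y Z. \<forall>f \<in> homs C X Y. \<forall>g \<in> homs C Y Z. g \<cdot>\<^bsub>C\<^esub> f \<in> homs C X Z) \<and>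
     (\<forall>X Y. \<forall>f \<in> homs C X Y. f \<cdot>\<^bsub>C\<^esub> Ide C X = f \<and> Ide C Y \<cdot>\<^bsub>C\<^esub> f = f) \<and>
     (\<forall>W X Y Z. \<forall>f \<in> homs C W X. \<forall>g \<in> homs C X Y. \<forall>h \<in> homs C Y Z.
        h \<cdot>\<^bsub>C\<^esub> (g \<cdot>\<^bsub>C\<^esub> f) = (h \<cdot>\<^bsub>C\<^esub> g) \<cdot>\<^bsub>C\<^esub> f)"

definition locally_small :: "'u itself \<Rightarrow> ('o, 'm) cat \<Rightarrow> bool" where
  "locally_small U C \<longleftrightarrow> (\<forall>X \<in> Obj C. \<forall>Y \<in> Obj C. small U (homs C X Y))"

definition op_cat :: "('o, 'm) cat \<Rightarrow> ('o, 'm) cat" where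
  "op_cat C = \<lparr>Obj = Obj C, Arr = Arr C, Dom = Cod C, Cod = Dom C, Ide = Ide C,
               Comp = (\<lambda>g f. f \<cdot>\<^bsub>C\<^esub> g)\<rparr>"

record ('o, 'm, 'p, 'n) func =
  ob :: "'o \<Rightarrow> 'p"
  ar :: "'m \<Rightarrow> 'n"

definition is_functor :: "('o, 'm) cat \<Rightarrow> ('p, 'n) cat \<Rightarrow> ('o, 'm, 'p, 'n) func \<Rightarrow> bool" where
  "is_functor C D F \<longleftrightarrow>
     category C \<and> category D \<and>
     (\<forall>X \<in> Obj C. ob F X \<in> Obj D) \<and>
     (\<forall>X Y. \<forall>f \<in> homs C X Y. ar F f \<in> homs D (ob F X) (ob F Y)) \<and>
     (\<forall>X \<in> Obj C. ar F (Ide C X) = Ide D (ob F X)) \<and>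
     (\<forall>X Y Z. \<forall>f \<in> homs C X Y. \<forall>g \<in> homs C Y Z.
        ar F (g \<cdot>\<^bsub>C\<^esub> f) = ar F g \<cdot>\<^bsub>D\<^esub> ar F f)"

definition id_func :: "('o, 'm, 'o, 'm) func" where
  "id_func = \<lparr>ob = id, ar = id\<rparr>"

definition comp_func ::
  "('p, 'n, 'q, 'k) func \<Rightarrow> ('o, 'm, 'p, 'n) func \<Rightarrow> ('o, 'm, 'q, 'k) func" where
  "comp_func G F = \<lparr>ob = ob G \<circ> ob F, ar = ar G \<circ> ar F\<rparr>"

definition nat_trans ::
  "('o, 'm) cat \<Rightarrow> ('p, 'n) cat \<Rightarrow> ('o, 'm, 'p, 'n) func \<Rightarrow> ('o, 'm, 'p, 'n) func
     \<Rightarrow> ('o \<Rightarrow> 'n) \<Rightarrow> bool" where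
  "nat_trans C D F G \<eta> \<longleftrightarrow>
     is_functor C D F \<and> is_functor C D G \<and>
     (\<forall>X \<in> Obj C. \<eta> X \<in> homs D (ob F X) (ob G X)) \<and>
     (\<forall>X Y. \<forall>f \<in> homs C X Y. \<eta> Y \<cdot>\<^bsub>D\<^esub> ar F f = ar G f \<cdot>\<^bsub>D\<^esub> \<eta> X)"

definition cotriple ::
  "('o, 'm) cat \<Rightarrow> ('o, 'm, 'o, 'm) func \<Rightarrow> ('o \<Rightarrow> 'm) \<Rightarrow> ('o \<Rightarrow> 'm) \<Rightarrow> bool" where
  "cotriple C S \<epsilon> \<Delta> \<longleftrightarrow>
     nat_trans C C S id_func \<epsilon> \<and>
     nat_trans C C S (comp_func S S) \<Delta> \<and>
     (\<forall>X \<in> Obj C. \<epsilon> (ob S X) \<cdot>\<^bsub>C\<^esub> \<Delta> X = Ide C (ob S X)) \<and>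
     (\<forall>X \<in> Obj C. ar S (\<epsilon> X) \<cdot>\<^bsub>C\<^esub> \<Delta> X = Ide C (ob S X)) \<and>
     (\<forall>X \<in> Obj C. ar S (\<Delta> X) \<cdot>\<^bsub>C\<^esub> \<Delta> X = \<Delta> (ob S X) \<cdot>\<^bsub>C\<^esub> \<Delta> X)"


section \<open>Colimits and limits\<close>

definition is_cocone ::
  "('j, 'a) cat \<Rightarrow> ('o, 'm) cat \<Rightarrow> ('j, 'a, 'o, 'm) func \<Rightarrow> 'o \<Rightarrow> ('j \<Rightarrow> 'm) \<Rightarrow> bool" where
  "is_cocone J C F L \<iota> \<longleftrightarrow>
     L \<in> Obj C \<and>
     (\<forall>j \<in> Obj J. \<iota> j \<in> homs C (ob F j) L) \<and>
     (\<forall>j k. \<forall>a \<in> homs J j k. \<iota> k \<cdot>\<^bsub>C\<^esub> ar F a = \<iota> j)"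

definition is_colimit ::
  "('j, 'a) cat \<Rightarrow> ('o, 'm) cat \<Rightarrow> ('j, 'a, 'o, 'm) func \<Rightarrow> 'o \<Rightarrow> ('j \<Rightarrow> 'm) \<Rightarrow> bool" where
  "is_colimit J C F L \<iota> \<longleftrightarrow>
     is_cocone J C F L \<iota> \<and>
     (\<forall>L' \<iota>'. is_cocone J C F L' \<iota>' \<longrightarrow>
        (\<exists>!u. u \<in> homs C L L' \<and> (\<forall>j \<in> Obj J. u \<cdot>\<^bsub>C\<^esub> \<iota> j = \<iota>' j)))"

definition is_limit ::
  "('j, 'a) cat \<Rightarrow> ('o, 'm) cat \<Rightarrow> ('j, 'a, 'o, 'm) func \<Rightarrow> 'o \<Rightarrow> ('j \<Rightarrow> 'm) \<Rightarrow> bool" where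
  "is_limit J C F L \<pi> \<longleftrightarrow> is_colimit (op_cat J) (op_cat C) F L \<pi>"

text \<open>
  Every small category is isomorphic to one whose objects and arrows are elements of \<open>'u\<close>, so it
  suffices to consider index categories of that form.
\<close>

definition cocomplete :: "'u itself \<Rightarrow> ('o, 'm) cat \<Rightarrow> bool" where
  "cocomplete U C \<longleftrightarrow>
     (\<forall>(J :: ('u, 'u) cat) F. is_functor J C F \<and> small U (Obj J) \<and> small U (Arr J) \<longrightarrow>
        (\<exists>L \<iota>. is_colimit J C F L \<iota>))"

definition complete :: "'u itself \<Rightarrow> ('o, 'm) cat \<Rightarrow> bool" where
  "complete U C \<longleftrightarrow>
     (\<forall>(J :: ('u, 'u) cat) F. is_functor J C F \<and> small U (Obj J) \<and> small U (Arr J) \<longrightarrow>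
        (\<exists>L \<pi>. is_limit J C F L \<pi>))"

definition is_initial :: "('o, 'm) cat \<Rightarrow> 'o \<Rightarrow> bool" where
  "is_initial C Z \<longleftrightarrow> Z \<in> Obj C \<and> (\<forall>X \<in> Obj C. \<exists>!f. f \<in> homs C Z X)"

definition is_coproduct ::
  "('o, 'm) cat \<Rightarrow> 'k set \<Rightarrow> ('k \<Rightarrow> 'o) \<Rightarrow> 'o \<Rightarrow> ('k \<Rightarrow> 'm) \<Rightarrow> bool" where
  "is_coproduct C K A P \<iota> \<longleftrightarrow>
     P \<in> Obj C \<and> (\<forall>k \<in> K. \<iota> k \<in> homs C (A k) P) \<and>
     (\<forall>Q \<kappa>. Q \<in> Obj C \<and> (\<forall>k \<in> K. \<kappa> k \<in> homs C (A k) Q) \<longrightarrow>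
        (\<exists>!u. u \<in> homs C P Q \<and> (\<forall>k \<in> K. u \<cdot>\<^bsub>C\<^esub> \<iota> k = \<kappa> k)))"

text \<open>
  \<open>is_pushout C f g p q\<close>: the span \<open>B \<leftarrow>f\<midarrow> A \<midarrow>g\<rightarrow> X\<close> has the pushout \<open>B \<midarrow>p\<rightarrow> P \<leftarrow>q\<midarrow> X\<close>.
\<close>

definition is_pushout :: "('o, 'm) cat \<Rightarrow> 'm \<Rightarrow> 'm \<Rightarrow> 'm \<Rightarrow> 'm \<Rightarrow> bool" where
  "is_pushout C f g p q \<longleftrightarrow>
     f \<in> Arr C \<and> g \<in> Arr C \<and> p \<in> Arr C \<and> q \<in> Arr C \<and>
     Dom C f = Dom C g \<and> Dom C p = Cod C f \<and> Dom C q = Cod C g \<and> Cod C p = Cod C q \<and>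
     p \<cdot>\<^bsub>C\<^esub> f = q \<cdot>\<^bsub>C\<^esub> g \<and>
     (\<forall>Y. \<forall>p' \<in> homs C (Cod C f) Y. \<forall>q' \<in> homs C (Cod C g) Y.
        p' \<cdot>\<^bsub>C\<^esub> f = q' \<cdot>\<^bsub>C\<^esub> g \<longrightarrow>
        (\<exists>!u. u \<in> homs C (Cod C p) Y \<and> u \<cdot>\<^bsub>C\<^esub> p = p' \<and> u \<cdot>\<^bsub>C\<^esub> q = q'))"


section \<open>Model categories\<close>

definition retract_of :: "('o, 'm) cat \<Rightarrow> 'm \<Rightarrow> 'm \<Rightarrow> bool" where
  "retract_of C f g \<longleftrightarrow>
     f \<in> Arr C \<and> g \<in> Arr C \<and>
     (\<exists>i \<in> homs C (Dom C f) (Dom C g). \<exists>r \<in> homs C (Dom C g) (Dom C f).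
      \<exists>j \<in> homs C (Cod C f) (Cod C g). \<exists>s \<in> homs C (Cod C g) (Cod C f).
        r \<cdot>\<^bsub>C\<^esub> i = Ide C (Dom C f) \<and> s \<cdot>\<^bsub>C\<^esub> j = Ide C (Cod C f) \<and>
        g \<cdot>\<^bsub>C\<^esub> i = j \<cdot>\<^bsub>C\<^esub> f \<and> f \<cdot>\<^bsub>C\<^esub> r = s \<cdot>\<^bsub>C\<^esub> g)"

definition has_lift :: "('o, 'm) cat \<Rightarrow> 'm \<Rightarrow> 'm \<Rightarrow> bool" where
  "has_lift C i p \<longleftrightarrow>
     (\<forall>u \<in> homs C (Dom C i) (Dom C p). \<forall>v \<in> homs C (Cod C i) (Cod C p).
        p \<cdot>\<^bsub>C\<^esub> u = v \<cdot>\<^bsub>C\<^esub> i \<longrightarrow>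
        (\<exists>h \<in> homs C (Cod C i) (Dom C p). h \<cdot>\<^bsub>C\<^esub> i = u \<and> p \<cdot>\<^bsub>C\<^esub> h = v))"

definition model_category ::
  "'u itself \<Rightarrow> ('o, 'm) cat \<Rightarrow> 'm set \<Rightarrow> 'm set \<Rightarrow> 'm set \<Rightarrow> bool" where
  "model_category U C Weq Cof Fib \<longleftrightarrow>
     category C \<and> locally_small U C \<and> complete U C \<and> cocomplete U C \<and>
     Weq \<subseteq> Arr C \<and> Cof \<subseteq> Arr C \<and> Fib \<subseteq> Arr C \<and>
     (\<forall>f \<in> Arr C. \<forall>g \<in> Arr C. Cod C f = Dom C g \<longrightarrow>
        (f \<in> Weq \<and> g \<in> Weq \<longrightarrow> g \<cdot>\<^bsub>C\<^esub> f \<in> Weq) \<and>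
        (f \<in> Weq \<and> g \<cdot>\<^bsub>C\<^esub> f \<in> Weq \<longrightarrow> g \<in> Weq) \<and>
        (g \<in> Weq \<and> g \<cdot>\<^bsub>C\<^esub> f \<in> Weq \<longrightarrow> f \<in> Weq)) \<and>
     (\<forall>K \<in> {Weq, Cof, Fib}. \<forall>f g. retract_of C f g \<and> g \<in> K \<longrightarrow> f \<in> K) \<and>
     (\<forall>i \<in> Cof. \<forall>p \<in> Fib \<inter> Weq. has_lift C i p) \<and>
     (\<forall>i \<in> Cof \<inter> Weq. \<forall>p \<in> Fib. has_lift C i p) \<and>
     (\<forall>f \<in> Arr C. \<exists>i \<in> Cof. \<exists>p \<in> Fib \<inter> Weq. Cod C i = Dom C p \<and> f = p \<cdot>\<^bsub>C\<^esub> i) \<and>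
     (\<forall>f \<in> Arr C. \<exists>i \<in> Cof \<inter> Weq. \<exists>p \<in> Fib. Cod C i = Dom C p \<and> f = p \<cdot>\<^bsub>C\<^esub> i)"


section \<open>Ordinals and transfinite sequences\<close>

text \<open>
  An ordinal is represented by a (reflexive) well-order \<open>r\<close>; its elements \<open>\<beta> \<in> Field r\<close> are the
  ordinals below it.
\<close>

definition small_ordinal :: "'u itself \<Rightarrow> 'u rel \<Rightarrow> bool" where
  "small_ordinal U r \<longleftrightarrow> Well_order r \<and> small U (Field r)"

text \<open>Regular ordinals are the infinite regular cardinals, regarded as initial ordinals.\<close>

definition regular_ordinal :: "'u itself \<Rightarrow> 'u rel \<Rightarrow> bool" where
  "regular_ordinal U r \<longleftrightarrow> small_ordinal U r \<and> Cinfinite r \<and> regularCard r"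

definition is_zero :: "'u rel \<Rightarrow> 'u \<Rightarrow> bool" where
  "is_zero r \<beta> \<longleftrightarrow> \<beta> \<in> Field r \<and> underS r \<beta> = {}"

text \<open>\<open>is_succ r \<beta> \<gamma>\<close>: \<open>\<gamma> = \<beta> + 1\<close>.\<close>

definition is_succ :: "'u rel \<Rightarrow> 'u \<Rightarrow> 'u \<Rightarrow> bool" where
  "is_succ r \<beta> \<gamma> \<longleftrightarrow> \<gamma> \<in> aboveS r \<beta> \<and> (\<forall>\<delta> \<in> aboveS r \<beta>. (\<gamma>, \<delta>) \<in> r)"

definition is_lim :: "'u rel \<Rightarrow> 'u \<Rightarrow> bool" where
  "is_lim r \<gamma> \<longleftrightarrow> \<gamma> \<in> Field r \<and> underS r \<gamma> \<noteq> {} \<and> \<not> (\<exists>\<beta>. is_succ r \<beta> \<gamma>)"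

text \<open>The poset category on \<open>A\<close>, with one arrow \<open>(\<beta>, \<gamma>)\<close> whenever \<open>\<beta> \<le> \<gamma>\<close>.\<close>

definition ord_cat :: "'u rel \<Rightarrow> 'u set \<Rightarrow> ('u, 'u \<times> 'u) cat" where
  "ord_cat r A = \<lparr>Obj = A, Arr = r \<inter> A \<times> A, Dom = fst, Cod = snd, Ide = (\<lambda>\<beta>. (\<beta>, \<beta>)),
                  Comp = (\<lambda>g f. (fst f, snd g))\<rparr>"

text \<open>A colimit-preserving functor from the ordinal \<open>r\<close> to \<open>C\<close>.\<close>

definition ord_sequence ::
  "'u rel \<Rightarrow> ('o, 'm) cat \<Rightarrow> ('u, 'u \<times> 'u, 'o, 'm) func \<Rightarrow> bool" where
  "ord_sequence r C F \<longleftrightarrow>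
     is_functor (ord_cat r (Field r)) C F \<and>
     (\<forall>\<gamma>. is_lim r \<gamma> \<longrightarrow>
        is_colimit (ord_cat r (underS r \<gamma>)) C F (ob F \<gamma>) (\<lambda>\<beta>. ar F (\<beta>, \<gamma>)))"

definition transfinite_composition ::
  "'u itself \<Rightarrow> ('o, 'm) cat \<Rightarrow> 'm set \<Rightarrow> 'm \<Rightarrow> bool" where
  "transfinite_composition U C P f \<longleftrightarrow>
     (\<exists>(r :: 'u rel) F L \<iota> \<beta>\<^sub>0.
        small_ordinal U r \<and> ord_sequence r C F \<and>
        (\<forall>\<beta> \<gamma>. is_succ r \<beta> \<gamma> \<longrightarrow> ar F (\<beta>, \<gamma>) \<in> P) \<and>
        is_colimit (ord_cat r (Field r)) C F L \<iota> \<and>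
        is_zero r \<beta>\<^sub>0 \<and> f = \<iota> \<beta>\<^sub>0)"

definition rel_cell_complex ::
  "'u itself \<Rightarrow> ('o, 'm) cat \<Rightarrow> 'i set \<Rightarrow> ('i \<Rightarrow> 'm) \<Rightarrow> 'm \<Rightarrow> bool" where
  "rel_cell_complex U C I \<phi> f \<longleftrightarrow>
     transfinite_composition U C {q. \<exists>i \<in> I. \<exists>g p. is_pushout C (\<phi> i) g p q} f"

text \<open>
  \<open>colim\<^bsub>\<beta>\<^esub> C(A, F \<beta>)\<close>, formed in sets as the quotient of the disjoint union by the relation of
  having a common image at some later stage.
\<close>

definition hom_sum ::
  "'u rel \<Rightarrow> ('o, 'm) cat \<Rightarrow> ('u, 'u \<times> 'u, 'o, 'm) func \<Rightarrow> 'o \<Rightarrow> ('u \<times> 'm) set" where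
  "hom_sum r C F A = (SIGMA \<beta> : Field r. homs C A (ob F \<beta>))"

definition hom_sum_rel ::
  "'u rel \<Rightarrow> ('o, 'm) cat \<Rightarrow> ('u, 'u \<times> 'u, 'o, 'm) func \<Rightarrow> 'o \<Rightarrow> ('u \<times> 'm) rel" where
  "hom_sum_rel r C F A =
     {((\<beta>, f), (\<gamma>, g)). (\<beta>, f) \<in> hom_sum r C F A \<and> (\<gamma>, g) \<in> hom_sum r C F A \<and>
        (\<exists>\<delta>. (\<beta>, \<delta>) \<in> r \<and> (\<gamma>, \<delta>) \<in> r \<and> ar F (\<beta>, \<delta>) \<cdot>\<^bsub>C\<^esub> f = ar F (\<gamma>, \<delta>) \<cdot>\<^bsub>C\<^esub> g)}"

definition hom_colim ::
  "'u rel \<Rightarrow> ('o, 'm) cat \<Rightarrow> ('u, 'u \<times> 'u, 'o, 'm) func \<Rightarrow> 'o \<Rightarrow> ('u \<times> 'm) set set" where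
  "hom_colim r C F A = hom_sum r C F A // hom_sum_rel r C F A"

definition hom_colim_map :: "('o, 'm) cat \<Rightarrow> ('u \<Rightarrow> 'm) \<Rightarrow> ('u \<times> 'm) set \<Rightarrow> 'm" where
  "hom_colim_map C \<iota> c = the_elem ((\<lambda>(\<beta>, f). \<iota> \<beta> \<cdot>\<^bsub>C\<^esub> f) ` c)"

text \<open>
  \<open>\<lambda>\<close>-smallness tests all \<open>\<mu>\<close>-sequences in \<open>K\<close> for regular \<open>\<mu> \<ge> \<lambda>\<close> (Hirschhorn's convention).
\<close>

definition small_relative ::
  "'u itself \<Rightarrow> ('o, 'm) cat \<Rightarrow> 'u rel \<Rightarrow> 'm set \<Rightarrow> 'o \<Rightarrow> bool" where
  "small_relative U C lam K A \<longleftrightarrow>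
     (\<forall>(mu :: 'u rel) F L \<iota>.
        regular_ordinal U mu \<and> lam \<le>o mu \<and> ord_sequence mu C F \<and>
        (\<forall>\<beta> \<gamma>. is_succ mu \<beta> \<gamma> \<longrightarrow> ar F (\<beta>, \<gamma>) \<in> K) \<and>
        is_colimit (ord_cat mu (Field mu)) C F L \<iota> \<longrightarrow>
        bij_betw (hom_colim_map C \<iota>) (hom_colim mu C F A) (homs C A L))"


section \<open>The small object argument\<close>

text \<open>
  Colimits are determined only up to isomorphism, so the construction is specified relationally: a
  value of the following type records one outcome, for arbitrary choices of the colimits.
  For \<open>\<beta> \<le> \<gamma> < \<lambda>\<close>:
  \<^item> \<open>stage \<beta> X\<close> is $S_\beta X$, and \<open>link \<beta> \<gamma> X\<close> the map $S_\beta X \to S_\gamma X$;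
  \<^item> \<open>aug \<beta> X\<close> is $\epsilon_\beta : S_\beta X \to X$;
  \<^item> \<open>cell \<beta> X d\<close> is the map $B_i \to S_{\beta+1} X$ of the square $d \in D_\beta(X)$;
  \<^item> \<open>stage_map \<beta> f\<close> is $S_\beta f$;
  \<^item> \<open>repl\<close> is the functor $S$, \<open>incl \<beta> X\<close> the map $S_\beta X \to SX$, and \<open>counit\<close> is $\epsilon$.
\<close>

record ('o, 'm, 'i, 'u) soa =
  stage :: "'u \<Rightarrow> 'o \<Rightarrow> 'o"
  link :: "'u \<Rightarrow> 'u \<Rightarrow> 'o \<Rightarrow> 'm"
  aug :: "'u \<Rightarrow> 'o \<Rightarrow> 'm"
  cell :: "'u \<Rightarrow> 'o \<Rightarrow> 'i \<times> 'm \<times> 'm \<Rightarrow> 'm"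
  stage_map :: "'u \<Rightarrow> 'm \<Rightarrow> 'm"
  repl :: "('o, 'm, 'o, 'm) func"
  incl :: "'u \<Rightarrow> 'o \<Rightarrow> 'm"
  counit :: "'o \<Rightarrow> 'm"

text \<open>
  The squares from some \<open>\<phi> i\<close> to \<open>e : T \<rightarrow> X\<close>, as triples of \<open>i\<close>, the map \<open>A\<^sub>i \<rightarrow> T\<close> and the map
  \<open>B\<^sub>i \<rightarrow> X\<close>.
\<close>

definition squares :: "('o, 'm) cat \<Rightarrow> 'i set \<Rightarrow> ('i \<Rightarrow> 'm) \<Rightarrow> 'm \<Rightarrow> ('i \<times> 'm \<times> 'm) set" where
  "squares C I \<phi> e =
     {(i, a, b). i \<in> I \<and> a \<in> homs C (Dom C (\<phi> i)) (Dom C e) \<and>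
                 b \<in> homs C (Cod C (\<phi> i)) (Cod C e) \<and> e \<cdot>\<^bsub>C\<^esub> a = b \<cdot>\<^bsub>C\<^esub> \<phi> i}"

text \<open>
  \<open>cell_pushout C \<phi> D t c\<close>: the map \<open>t\<close> together with the components \<open>c d : B\<^sub>i \<rightarrow> Cod t\<close> exhibits
  \<open>Cod t\<close> as the pushout of \<open>\<Coprod>B\<^sub>i \<leftarrow> \<Coprod>A\<^sub>i \<rightarrow> Dom t\<close>, the coproducts being taken over \<open>D\<close>.
\<close>

definition cell_pushout ::
  "('o, 'm) cat \<Rightarrow> ('i \<Rightarrow> 'm) \<Rightarrow> ('i \<times> 'm \<times> 'm) set \<Rightarrow> 'm \<Rightarrow> ('i \<times> 'm \<times> 'm \<Rightarrow> 'm) \<Rightarrow> bool" where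
  "cell_pushout C \<phi> D t c \<longleftrightarrow>
     (\<exists>PA \<iota>A PB \<iota>B \<Phi> att k.
        is_coproduct C D (\<lambda>(i, a, b). Dom C (\<phi> i)) PA \<iota>A \<and>
        is_coproduct C D (\<lambda>(i, a, b). Cod C (\<phi> i)) PB \<iota>B \<and>
        \<Phi> \<in> homs C PA PB \<and> att \<in> homs C PA (Dom C t) \<and>
        (\<forall>(i, a, b) \<in> D. \<Phi> \<cdot>\<^bsub>C\<^esub> \<iota>A (i, a, b) = \<iota>B (i, a, b) \<cdot>\<^bsub>C\<^esub> \<phi> i \<and>
                         att \<cdot>\<^bsub>C\<^esub> \<iota>A (i, a, b) = a) \<and>
        is_pushout C \<Phi> att k t \<and>
        (\<forall>d \<in> D. c d = k \<cdot>\<^bsub>C\<^esub> \<iota>B d))"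

definition stage_chain ::
  "('o, 'm, 'i, 'u) soa \<Rightarrow> 'o \<Rightarrow> ('u, 'u \<times> 'u, 'o, 'm) func" where
  "stage_chain S X = \<lparr>ob = (\<lambda>\<beta>. stage S \<beta> X), ar = (\<lambda>(\<beta>, \<gamma>). link S \<beta> \<gamma> X)\<rparr>"

definition small_object_argument ::
  "('o, 'm) cat \<Rightarrow> 'o \<Rightarrow> 'i set \<Rightarrow> ('i \<Rightarrow> 'm) \<Rightarrow> 'u rel \<Rightarrow> ('o, 'm, 'i, 'u) soa \<Rightarrow> bool" where
  "small_object_argument C zero I \<phi> lam S \<longleftrightarrow>
     \<comment> \<open>the stages and their augmentations\<close>
     (\<forall>X \<in> Obj C.
        ord_sequence lam C (stage_chain S X) \<and>
        (\<forall>\<beta>. is_zero lam \<beta> \<longrightarrow> stage S \<beta> X = zero) \<and>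
        is_cocone (ord_cat lam (Field lam)) C (stage_chain S X) X (\<lambda>\<beta>. aug S \<beta> X) \<and>
        (\<forall>\<beta> \<gamma>. is_succ lam \<beta> \<gamma> \<longrightarrow>
           cell_pushout C \<phi> (squares C I \<phi> (aug S \<beta> X)) (link S \<beta> \<gamma> X) (cell S \<beta> X) \<and>
           (\<forall>(i, a, b) \<in> squares C I \<phi> (aug S \<beta> X).
              aug S \<gamma> X \<cdot>\<^bsub>C\<^esub> cell S \<beta> X (i, a, b) = b)) \<and>
        is_colimit (ord_cat lam (Field lam)) C (stage_chain S X) (ob (repl S) X)
          (\<lambda>\<beta>. incl S \<beta> X) \<and>
        counit S X \<in> homs C (ob (repl S) X) X \<and>
        (\<forall>\<beta> \<in> Field lam. counit S X \<cdot>\<^bsub>C\<^esub> incl S \<beta> X = aug S \<beta> X)) \<and>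
     \<comment> \<open>the action on maps, which these equations determine\<close>
     (\<forall>X Y. \<forall>f \<in> homs C X Y.
        (\<forall>\<beta> \<in> Field lam. stage_map S \<beta> f \<in> homs C (stage S \<beta> X) (stage S \<beta> Y)) \<and>
        (\<forall>\<beta> \<gamma>. (\<beta>, \<gamma>) \<in> lam \<longrightarrow>
           stage_map S \<gamma> f \<cdot>\<^bsub>C\<^esub> link S \<beta> \<gamma> X = link S \<beta> \<gamma> Y \<cdot>\<^bsub>C\<^esub> stage_map S \<beta> f) \<and>
        (\<forall>\<beta> \<gamma>. is_succ lam \<beta> \<gamma> \<longrightarrow>
           (\<forall>(i, a, b) \<in> squares C I \<phi> (aug S \<beta> X).
              stage_map S \<gamma> f \<cdot>\<^bsub>C\<^esub> cell S \<beta> X (i, a, b) =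
              cell S \<beta> Y (i, stage_map S \<beta> f \<cdot>\<^bsub>C\<^esub> a, f \<cdot>\<^bsub>C\<^esub> b))) \<and>
        ar (repl S) f \<in> homs C (ob (repl S) X) (ob (repl S) Y) \<and>
        (\<forall>\<beta> \<in> Field lam.
           ar (repl S) f \<cdot>\<^bsub>C\<^esub> incl S \<beta> X = incl S \<beta> Y \<cdot>\<^bsub>C\<^esub> stage_map S \<beta> f))"

end

theory Submission
  imports Defs
begin

text \<open>
  The comultiplication respects the stages: \<open>\<Delta>\<^sub>\<beta> : S\<^sub>\<beta> X \<rightarrow> S\<^sub>\<beta> (S X)\<close> lies over the inclusion
  \<open>S\<^sub>\<beta> X \<rightarrow> S X\<close> and sends the cell of the square \<open>(i, a, b)\<close> to the cell of the square
  \<open>(i, \<Delta>\<^sub>\<beta> a, c)\<close>, where \<open>c : B\<^sub>i \<rightarrow> S\<^sub>\<beta>\<^sub>+\<^sub>1 X \<rightarrow> S X\<close> is the given cell itself.  Every identity then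
  holds by transfinite induction, because maps out of a stage are determined by their restrictions
  to the earlier stages and to the cells.
\<close>

text \<open>Lifting the cofibrant object \<open>SO X\<close> against the acyclic fibration
  \<open>counit S (SO X)\<close> yields a section of that map, but a lift is a choice: it need be
  neither natural nor coassociative. Strict identities are possible because each successor step
  attaches exactly one cell for every square, so that a square names its cell and maps can be
  compared by comparing names. The entry c is forced: the augmentation returns the third entry of
  the square on its cell, and \<Delta> at a stage is to lie over the inclusion. The same entry makes
  S\<epsilon> invert \<Delta>, since \<epsilon> c = b. The obstacle is that the target cell exists
  only if (i, \<Delta> a, c) really is a square over \<open>SO X\<close>, and this already uses that
  \<Delta> lies over the inclusion at the stage before. Construction and this property must
  therefore be established in one induction.\<close>

locale small_object_functor =
  fixes C :: "('o, 'm) cat" (structure)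
    and zero :: 'o
    and I :: "'i set"
    and \<phi> :: "'i \<Rightarrow> 'm"
    and lam :: "'u rel"
    and S :: "('o, 'm, 'i, 'u) soa"
  assumes category: "category C"
    and initial: "is_initial C zero"
    and gen_arr: "i \<in> I \<Longrightarrow> \<phi> i \<in> Arr C"
    and wo: "Well_order lam"
    and soa: "small_object_argument C zero I \<phi> lam S"
begin

abbreviation SO :: "'o \<Rightarrow> 'o" where "SO X \<equiv> ob (repl S) X"

abbreviation sq :: "'u \<Rightarrow> 'o \<Rightarrow> ('i \<times> 'm \<times> 'm) set" where
  "sq \<beta> X \<equiv> squares C I \<phi> (aug S \<beta> X)"

subsection \<open>Categories and well-orders\<close>

lemma comp_hom: "f \<in> homs C X Y \<Longrightarrow> g \<in> homs C Y Z \<Longrightarrow> g \<cdot> f \<in> homs C X Z"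
  using category unfolding category_def by blast

lemma comp_assoc:
  "f \<in> homs C W X \<Longrightarrow> g \<in> homs C X Y \<Longrightarrow> h \<in> homs C Y Z \<Longrightarrow> (h \<cdot> g) \<cdot> f = h \<cdot> (g \<cdot> f)"
  using category unfolding category_def by metis

lemma comp_id: "f \<in> homs C X Y \<Longrightarrow> f \<cdot> Ide C X = f" "f \<in> homs C X Y \<Longrightarrow> Ide C Y \<cdot> f = f"
  using category unfolding category_def by blast+

lemma id_hom: "X \<in> Obj C \<Longrightarrow> Ide C X \<in> homs C X X"
  using category unfolding category_def by blast

lemma hom_obj: assumes "f \<in> homs C X Y" shows "X \<in> Obj C" "Y \<in> Obj C"
  using category assms unfolding category_def homs_def by auto

lemma gen_hom: "i \<in> I \<Longrightarrow> \<phi> i \<in> homs C (Dom C (\<phi> i)) (Cod C (\<phi> i))"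
  using gen_arr by (simp add: homs_def)

lemma lam_refl: "\<beta> \<in> Field lam \<Longrightarrow> (\<beta>, \<beta>) \<in> lam"
  using wo by (simp add: order_on_defs refl_on_def)

lemma lam_trans: "(\<alpha>, \<beta>) \<in> lam \<Longrightarrow> (\<beta>, \<gamma>) \<in> lam \<Longrightarrow> (\<alpha>, \<gamma>) \<in> lam"
  using wo by (meson order_on_defs transD)

lemma lam_antisym: "(\<alpha>, \<beta>) \<in> lam \<Longrightarrow> (\<beta>, \<alpha>) \<in> lam \<Longrightarrow> \<alpha> = \<beta>"
  using wo by (meson order_on_defs antisymD)

lemma lam_total:
  "\<alpha> \<in> Field lam \<Longrightarrow> \<beta> \<in> Field lam \<Longrightarrow> (\<alpha>, \<beta>) \<in> lam \<or> (\<beta>, \<alpha>) \<in> lam"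
  using wo lam_refl unfolding order_on_defs total_on_def by metis

lemma lam_field:
  assumes "(\<alpha>, \<beta>) \<in> lam"
  shows "\<alpha> \<in> Field lam" "\<beta> \<in> Field lam"
  using assms by (auto simp: Field_def)

lemma lam_wf: "wf (lam - Id)"
  using wo by (simp add: well_order_on_def)

lemma underS_iff: "\<beta> \<in> underS lam \<gamma> \<longleftrightarrow> (\<beta>, \<gamma>) \<in> lam - Id"
  by (auto simp: underS_def)

lemma is_succD:
  assumes "is_succ lam \<beta> \<gamma>"
  shows "\<beta> \<in> underS lam \<gamma>" "(\<beta>, \<gamma>) \<in> lam" "\<beta> \<in> Field lam" "\<gamma> \<in> Field lam"
  using assms by (auto simp: is_succ_def aboveS_def underS_def Field_def)

text \<open>By totality an \<alpha> below \<gamma> with \<alpha> \<le> \<beta> false would lie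
  strictly above \<beta>, and leastness of \<gamma> would give \<gamma> \<le> \<alpha>. This reduces
  conditions on all earlier stages to the predecessor alone.\<close>

lemma is_succ_below:
  assumes "is_succ lam \<beta> \<gamma>" "\<alpha> \<in> underS lam \<gamma>"
  shows "(\<alpha>, \<beta>) \<in> lam"
proof (rule ccontr)
  assume n: "(\<alpha>, \<beta>) \<notin> lam"
  have "\<alpha> \<in> Field lam" "(\<alpha>, \<gamma>) \<in> lam" "\<alpha> \<noteq> \<gamma>"
    using assms(2) by (auto simp: underS_def Field_def)
  moreover from this n have "(\<beta>, \<alpha>) \<in> lam" "\<alpha> \<noteq> \<beta>"
    using lam_total lam_refl is_succD[OF assms(1)] by blast+
  then have "(\<gamma>, \<alpha>) \<in> lam"
    using assms(1) by (auto simp: is_succ_def aboveS_def)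
  ultimately show False
    using lam_antisym by blast
qed

lemma is_succ_unique: "is_succ lam \<beta> \<gamma> \<Longrightarrow> is_succ lam \<beta>' \<gamma> \<Longrightarrow> \<beta>' = \<beta>"
  by (meson is_succ_below is_succD lam_antisym)

lemma ord_cat_homs:
  "homs (ord_cat r A) \<alpha> \<beta> = {f. f = (\<alpha>, \<beta>) \<and> f \<in> r \<and> \<alpha> \<in> A \<and> \<beta> \<in> A}"
  by (auto simp: ord_cat_def homs_def)

lemma field_cases:
  assumes "\<gamma> \<in> Field lam"
  obtains "is_zero lam \<gamma>" | \<beta> where "is_succ lam \<beta> \<gamma>" | "is_lim lam \<gamma>"
  using assms unfolding is_zero_def is_lim_def by blast

subsection \<open>The structure of the stages\<close>

text \<open>\<open>squares\<close> reads its objects off the domain and codomain of the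
  augmentation. This rule and \<open>sqI\<close> trade them for named objects through a typing
  assumption.\<close>

lemma sq_homs:
  assumes "(i, a, b) \<in> sq \<beta> X" "aug S \<beta> X \<in> homs C T Y"
  shows "i \<in> I" "a \<in> homs C (Dom C (\<phi> i)) T" "b \<in> homs C (Cod C (\<phi> i)) Y"
    "aug S \<beta> X \<cdot> a = b \<cdot> \<phi> i"
  using assms by (auto simp: squares_def homs_def)

lemma sqI:
  assumes "i \<in> I" "a \<in> homs C (Dom C (\<phi> i)) T" "b \<in> homs C (Cod C (\<phi> i)) Y"
    "aug S \<beta> X \<cdot> a = b \<cdot> \<phi> i" "aug S \<beta> X \<in> homs C T Y"
  shows "(i, a, b) \<in> sq \<beta> X"
  using assms by (auto simp: squares_def homs_def)

context
  fixes X
  assumes X: "X \<in> Obj C"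
begin

lemma chain: "ord_sequence lam C (stage_chain S X)"
  using soa X unfolding small_object_argument_def by blast

lemma chain_functor: "is_functor (ord_cat lam (Field lam)) C (stage_chain S X)"
  using chain unfolding ord_sequence_def by blast

lemma stage_obj: "\<beta> \<in> Field lam \<Longrightarrow> stage S \<beta> X \<in> Obj C"
  using chain_functor unfolding is_functor_def by (simp add: ord_cat_def stage_chain_def)

lemma link_hom: "(\<beta>, \<gamma>) \<in> lam \<Longrightarrow> link S \<beta> \<gamma> X \<in> homs C (stage S \<beta> X) (stage S \<gamma> X)"
  using chain_functor lam_field unfolding is_functor_def ord_cat_homs
  by (simp add: stage_chain_def)

lemma link_id: "\<beta> \<in> Field lam \<Longrightarrow> link S \<beta> \<beta> X = Ide C (stage S \<beta> X)"
  using chain_functor unfolding is_functor_def by (simp add: ord_cat_def stage_chain_def)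

lemma link_link:
  assumes "(\<alpha>, \<beta>) \<in> lam" "(\<beta>, \<gamma>) \<in> lam"
  shows "link S \<beta> \<gamma> X \<cdot> link S \<alpha> \<beta> X = link S \<alpha> \<gamma> X"
proof -
  have "(\<alpha>, \<beta>) \<in> homs (ord_cat lam (Field lam)) \<alpha> \<beta>"
    "(\<beta>, \<gamma>) \<in> homs (ord_cat lam (Field lam)) \<beta> \<gamma>"
    using assms lam_field by (auto simp: ord_cat_homs)
  moreover have "\<forall>X' Y Z. \<forall>f \<in> homs (ord_cat lam (Field lam)) X' Y.
      \<forall>g \<in> homs (ord_cat lam (Field lam)) Y Z.
        ar (stage_chain S X) (g \<cdot>\<^bsub>ord_cat lam (Field lam)\<^esub> f) =
        ar (stage_chain S X) g \<cdot> ar (stage_chain S X) f"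
    using chain_functor unfolding is_functor_def by blast
  ultimately have "ar (stage_chain S X) ((\<beta>, \<gamma>) \<cdot>\<^bsub>ord_cat lam (Field lam)\<^esub> (\<alpha>, \<beta>)) =
      ar (stage_chain S X) (\<beta>, \<gamma>) \<cdot> ar (stage_chain S X) (\<alpha>, \<beta>)"
    by blast
  then show ?thesis
    by (simp add: ord_cat_def stage_chain_def)
qed

text \<open>Kept general in \<open>A\<close> because two diagrams occur: all of
  \<open>Field lam\<close> for the colimit \<open>SO X\<close>, and \<open>underS lam\<close> for
  limit stages.\<close>

lemma cocone_iff:
  assumes "A \<subseteq> Field lam"
  shows "is_cocone (ord_cat lam A) C (stage_chain S X) L \<iota> \<longleftrightarrow>
    L \<in> Obj C \<and> (\<forall>\<beta> \<in> A. \<iota> \<beta> \<in> homs C (stage S \<beta> X) L) \<and>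
    (\<forall>\<alpha> \<in> A. \<forall>\<beta> \<in> A. (\<alpha>, \<beta>) \<in> lam \<longrightarrow> \<iota> \<beta> \<cdot> link S \<alpha> \<beta> X = \<iota> \<alpha>)"
  unfolding is_cocone_def ord_cat_homs by (auto simp: ord_cat_def stage_chain_def)

lemma aug_cocone: "is_cocone (ord_cat lam (Field lam)) C (stage_chain S X) X (\<lambda>\<beta>. aug S \<beta> X)"
  using soa X unfolding small_object_argument_def by blast

lemma aug_hom: "\<beta> \<in> Field lam \<Longrightarrow> aug S \<beta> X \<in> homs C (stage S \<beta> X) X"
  using aug_cocone by (simp add: cocone_iff)

lemma aug_link: "(\<alpha>, \<beta>) \<in> lam \<Longrightarrow> aug S \<beta> X \<cdot> link S \<alpha> \<beta> X = aug S \<alpha> X"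
  using aug_cocone lam_field by (simp add: cocone_iff)

section \<open>The colimit of the stages and its universal property\<close>

lemma repl_colimit:
  "is_colimit (ord_cat lam (Field lam)) C (stage_chain S X) (SO X) (\<lambda>\<beta>. incl S \<beta> X)"
  using soa X unfolding small_object_argument_def by blast

lemma repl_cocone:
  "is_cocone (ord_cat lam (Field lam)) C (stage_chain S X) (SO X) (\<lambda>\<beta>. incl S \<beta> X)"
  using repl_colimit unfolding is_colimit_def by blast

lemma repl_obj: "SO X \<in> Obj C"
  using repl_cocone by (simp add: cocone_iff)

lemma incl_hom: "\<beta> \<in> Field lam \<Longrightarrow> incl S \<beta> X \<in> homs C (stage S \<beta> X) (SO X)"
  using repl_cocone by (simp add: cocone_iff)

lemma incl_link: "(\<alpha>, \<beta>) \<in> lam \<Longrightarrow> incl S \<beta> X \<cdot> link S \<alpha> \<beta> X = incl S \<alpha> X"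
  using repl_cocone lam_field by (simp add: cocone_iff)

lemma repl_ex:
  assumes Z: "Z \<in> Obj C" and m: "\<And>\<beta>. \<beta> \<in> Field lam \<Longrightarrow> m \<beta> \<in> homs C (stage S \<beta> X) Z"
    and ml: "\<And>\<alpha> \<beta>. (\<alpha>, \<beta>) \<in> lam \<Longrightarrow> m \<beta> \<cdot> link S \<alpha> \<beta> X = m \<alpha>"
  shows "\<exists>h \<in> homs C (SO X) Z. \<forall>\<beta> \<in> Field lam. h \<cdot> incl S \<beta> X = m \<beta>"
proof -
  have "is_cocone (ord_cat lam (Field lam)) C (stage_chain S X) Z m"
    using assms by (simp add: cocone_iff)
  then show ?thesis
    using repl_colimit unfolding is_colimit_def by (auto simp: ord_cat_def dest!: spec)
qed

text \<open>The restrictions of \<open>f\<close> form a cocone, and both \<open>f\<close> and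
  \<open>g\<close> mediate it.\<close>

lemma repl_eqI:
  assumes f: "f \<in> homs C (SO X) Z" and g: "g \<in> homs C (SO X) Z"
    and eq: "\<And>\<beta>. \<beta> \<in> Field lam \<Longrightarrow> f \<cdot> incl S \<beta> X = g \<cdot> incl S \<beta> X"
  shows "f = g"
proof -
  have "is_cocone (ord_cat lam (Field lam)) C (stage_chain S X) Z (\<lambda>\<beta>. f \<cdot> incl S \<beta> X)"
    using hom_obj[OF f] comp_hom[OF incl_hom f] comp_assoc[OF link_hom incl_hom f] incl_link
    by (auto simp: cocone_iff)
  then have "\<exists>!u. u \<in> homs C (SO X) Z \<and>
      (\<forall>\<beta> \<in> Field lam. u \<cdot> incl S \<beta> X = f \<cdot> incl S \<beta> X)"
    using repl_colimit unfolding is_colimit_def by (simp add: ord_cat_def)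
  then show ?thesis
    using f g eq by metis
qed

lemma counit_hom: "counit S X \<in> homs C (SO X) X"
  using soa X unfolding small_object_argument_def by blast

lemma counit_incl: "\<beta> \<in> Field lam \<Longrightarrow> counit S X \<cdot> incl S \<beta> X = aug S \<beta> X"
  using soa X unfolding small_object_argument_def by blast

lemma zero_stage: "is_zero lam \<beta> \<Longrightarrow> stage S \<beta> X = zero"
  using soa X unfolding small_object_argument_def by blast

lemma aug_cell:
  "is_succ lam \<beta> \<gamma> \<Longrightarrow> (i, a, b) \<in> sq \<beta> X \<Longrightarrow> aug S \<gamma> X \<cdot> cell S \<beta> X (i, a, b) = b"
  using soa X unfolding small_object_argument_def by blast

section \<open>Maps out of a single stage\<close>

lemma succ_pushout:
  "is_succ lam \<beta> \<gamma> \<Longrightarrow> cell_pushout C \<phi> (sq \<beta> X) (link S \<beta> \<gamma> X) (cell S \<beta> X)"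
  using soa X unfolding small_object_argument_def by blast

text \<open>Eliminates the coproducts: a map out of the coproduct of the B's is its family of
  components, and compatibility with the attaching map can be tested on each A separately. Later
  arguments see only links and cells.\<close>

lemma succ_universal:
  assumes s: "is_succ lam \<beta> \<gamma>"
  shows "(i, a, b) \<in> sq \<beta> X \<Longrightarrow>
      cell S \<beta> X (i, a, b) \<in> homs C (Cod C (\<phi> i)) (stage S \<gamma> X) \<and>
      cell S \<beta> X (i, a, b) \<cdot> \<phi> i = link S \<beta> \<gamma> X \<cdot> a" (is "?sq \<Longrightarrow> ?cell")
    and "\<lbrakk>m \<in> homs C (stage S \<beta> X) Z;
      \<And>i a b. (i, a, b) \<in> sq \<beta> X \<Longrightarrow>
        e (i, a, b) \<in> homs C (Cod C (\<phi> i)) Z \<and> e (i, a, b) \<cdot> \<phi> i = m \<cdot> a\<rbrakk> \<Longrightarrow>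
      \<exists>!h. h \<in> homs C (stage S \<gamma> X) Z \<and> h \<cdot> link S \<beta> \<gamma> X = m \<and>
        (\<forall>d \<in> sq \<beta> X. h \<cdot> cell S \<beta> X d = e d)" (is "?m \<Longrightarrow> PROP ?e \<Longrightarrow> ?ex")
proof -
  let ?D = "sq \<beta> X" and ?t = "link S \<beta> \<gamma> X" and ?c = "cell S \<beta> X"
  have t: "?t \<in> homs C (stage S \<beta> X) (stage S \<gamma> X)"
    using link_hom is_succD[OF s] by blast
  then have Dt: "Dom C ?t = stage S \<beta> X" and Ct: "Cod C ?t = stage S \<gamma> X"
    by (auto simp: homs_def)
  obtain PA \<iota>A PB \<iota>B \<Phi> att k where
    PA: "is_coproduct C ?D (\<lambda>(i, a, b). Dom C (\<phi> i)) PA \<iota>A" and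
    PB: "is_coproduct C ?D (\<lambda>(i, a, b). Cod C (\<phi> i)) PB \<iota>B" and
    \<Phi>: "\<Phi> \<in> homs C PA PB" and att: "att \<in> homs C PA (stage S \<beta> X)" and
    comm: "\<forall>(i, a, b) \<in> ?D. \<Phi> \<cdot> \<iota>A (i, a, b) = \<iota>B (i, a, b) \<cdot> \<phi> i \<and>
      att \<cdot> \<iota>A (i, a, b) = a" and
    po: "is_pushout C \<Phi> att k ?t" and c: "\<forall>d \<in> ?D. ?c d = k \<cdot> \<iota>B d"
    using succ_pushout[OF s] unfolding cell_pushout_def Dt by blast
  have C\<Phi>: "Cod C \<Phi> = PB" and Catt: "Cod C att = stage S \<beta> X"
    using \<Phi> att by (auto simp: homs_def)
  have k: "k \<in> homs C PB (stage S \<gamma> X)" and k\<Phi>: "k \<cdot> \<Phi> = ?t \<cdot> att"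
    using po C\<Phi> Ct unfolding is_pushout_def homs_def by auto
  have Ck: "Cod C k = stage S \<gamma> X"
    using k by (simp add: homs_def)
  have \<iota>A: "\<iota>A (i, a, b) \<in> homs C (Dom C (\<phi> i)) PA"
    and \<iota>B: "\<iota>B (i, a, b) \<in> homs C (Cod C (\<phi> i)) PB"
    and \<phi>: "\<phi> i \<in> homs C (Dom C (\<phi> i)) (Cod C (\<phi> i))"
    and \<Phi>A: "\<Phi> \<cdot> \<iota>A (i, a, b) = \<iota>B (i, a, b) \<cdot> \<phi> i"
    and attA: "att \<cdot> \<iota>A (i, a, b) = a"
    if "(i, a, b) \<in> ?D" for i a b
    using that PA PB comm gen_hom unfolding is_coproduct_def
    by (fastforce simp: squares_def)+
  show ?cell if d: ?sq
  proof -
    have "?c (i, a, b) \<cdot> \<phi> i = k \<cdot> (\<iota>B (i, a, b) \<cdot> \<phi> i)"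
      using c d comp_assoc[OF \<phi> \<iota>B k] by auto
    also have "\<dots> = (?t \<cdot> att) \<cdot> \<iota>A (i, a, b)"
      by (metis \<Phi>A[OF d] comp_assoc[OF \<iota>A[OF d] \<Phi> k] k\<Phi>)
    also have "\<dots> = ?t \<cdot> a"
      by (metis attA[OF d] comp_assoc[OF \<iota>A[OF d] att t])
    finally show ?thesis
      using c d comp_hom[OF \<iota>B[OF d] k] by auto
  qed
  show ?ex if m: ?m and e: "PROP ?e"
  proof -
    have Z: "Z \<in> Obj C"
      using m hom_obj by blast
    have "\<forall>d \<in> ?D. e d \<in> homs C ((\<lambda>(i, a, b). Cod C (\<phi> i)) d) Z"
      using e by auto
    then have ex1: "\<exists>!u. u \<in> homs C PB Z \<and> (\<forall>d \<in> ?D. u \<cdot> \<iota>B d = e d)"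
      using PB Z unfolding is_coproduct_def by blast
    then obtain u where u: "u \<in> homs C PB Z" and ue: "\<forall>d \<in> ?D. u \<cdot> \<iota>B d = e d"
      by blast
    have u1: "u' = u" if "u' \<in> homs C PB Z" "\<forall>d \<in> ?D. u' \<cdot> \<iota>B d = e d" for u'
      using ex1 u ue that by blast
    \<comment> \<open>The pushout needs \<open>u\<close> and \<open>m\<close> to agree on the
      coproduct of the A's. On one summand this is exactly the hypothesis on
      \<open>e\<close>.\<close>
    have "(u \<cdot> \<Phi>) \<cdot> \<iota>A d = (m \<cdot> att) \<cdot> \<iota>A d" if "d \<in> ?D" for d
    proof -
      obtain i a b where d: "d = (i, a, b)" "(i, a, b) \<in> ?D"
        using \<open>d \<in> ?D\<close> by (cases d) auto
      have "(u \<cdot> \<Phi>) \<cdot> \<iota>A d = (u \<cdot> \<iota>B d) \<cdot> \<phi> i"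
        using comp_assoc[OF \<iota>A[OF d(2)] \<Phi> u] comp_assoc[OF \<phi>[OF d(2)] \<iota>B[OF d(2)] u]
          \<Phi>A[OF d(2)] d(1) by simp
      also have "\<dots> = m \<cdot> a"
        using ue e d by auto
      also have "\<dots> = (m \<cdot> att) \<cdot> \<iota>A d"
        using comp_assoc[OF \<iota>A[OF d(2)] att m] attA[OF d(2)] d(1) by simp
      finally show ?thesis .
    qed
    \<comment> \<open>The uniqueness half of the coproduct \<open>PA\<close>, taken for the family
      to which both \<open>u \<cdot> \<Phi>\<close> and \<open>m \<cdot> att\<close> restrict,
      identifies the two.\<close>
    moreover have "\<exists>!v. v \<in> homs C PA Z \<and> (\<forall>d \<in> ?D. v \<cdot> \<iota>A d = (m \<cdot> att) \<cdot> \<iota>A d)"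
    proof -
      have "\<forall>d \<in> ?D. (m \<cdot> att) \<cdot> \<iota>A d \<in> homs C ((\<lambda>(i, a, b). Dom C (\<phi> i)) d) Z"
        using \<iota>A comp_hom[OF _ comp_hom[OF att m]] by auto
      moreover have "(\<forall>d \<in> ?D. \<kappa> d \<in> homs C ((\<lambda>(i, a, b). Dom C (\<phi> i)) d) Z) \<longrightarrow>
          (\<exists>!v. v \<in> homs C PA Z \<and> (\<forall>d \<in> ?D. v \<cdot> \<iota>A d = \<kappa> d))" for \<kappa>
        using PA Z unfolding is_coproduct_def by blast
      ultimately show ?thesis
        by (rule rev_mp)
    qed
    ultimately have "u \<cdot> \<Phi> = m \<cdot> att"
      using comp_hom[OF \<Phi> u] comp_hom[OF att m] by metis
    then have ex: "\<exists>!h. h \<in> homs C (stage S \<gamma> X) Z \<and> h \<cdot> k = u \<and> h \<cdot> ?t = m"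
      using po u m unfolding is_pushout_def C\<Phi> Catt Ck by blast
    \<comment> \<open>Uniqueness of \<open>u\<close> among maps with components \<open>e\<close>
      turns the pushout condition on the leg \<open>k\<close> into one condition per cell.\<close>
    have "h \<cdot> k = u \<longleftrightarrow> (\<forall>d \<in> ?D. h \<cdot> ?c d = e d)" if h: "h \<in> homs C (stage S \<gamma> X) Z" for h
    proof -
      have "h \<cdot> ?c d = (h \<cdot> k) \<cdot> \<iota>B d" if "d \<in> ?D" for d
        using that c comp_assoc[OF \<iota>B k h] by (cases d) auto
      then show ?thesis
        using u1[OF comp_hom[OF k h]] ue by auto
    qed
    then show ?thesis
      using ex by (metis (no_types, lifting))
  qed
qed

lemmas cell_hom = succ_universal(1)[THEN conjunct1]
lemmas cell_gen = succ_universal(1)[THEN conjunct2]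

text \<open>One universal property for all three kinds of ordinals, so that later inductions need no
  case distinction. At zero both families of conditions are empty and initiality remains; at a limit
  only the links count; at a successor the link from the predecessor and the cells do.\<close>

lemma stage_universal:
  assumes \<gamma>: "\<gamma> \<in> Field lam" and Z: "Z \<in> Obj C"
    and m: "\<And>\<beta>. \<beta> \<in> underS lam \<gamma> \<Longrightarrow> m \<beta> \<in> homs C (stage S \<beta> X) Z"
    and ml: "\<And>\<alpha> \<beta>. \<beta> \<in> underS lam \<gamma> \<Longrightarrow> (\<alpha>, \<beta>) \<in> lam \<Longrightarrow> m \<beta> \<cdot> link S \<alpha> \<beta> X = m \<alpha>"
    and e: "\<And>\<beta> i a b. is_succ lam \<beta> \<gamma> \<Longrightarrow> (i, a, b) \<in> sq \<beta> X \<Longrightarrow>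
        e \<beta> (i, a, b) \<in> homs C (Cod C (\<phi> i)) Z \<and> e \<beta> (i, a, b) \<cdot> \<phi> i = m \<beta> \<cdot> a"
  shows "\<exists>!h. h \<in> homs C (stage S \<gamma> X) Z \<and>
    (\<forall>\<beta> \<in> underS lam \<gamma>. h \<cdot> link S \<beta> \<gamma> X = m \<beta>) \<and>
    (\<forall>\<beta>. is_succ lam \<beta> \<gamma> \<longrightarrow> (\<forall>d \<in> sq \<beta> X. h \<cdot> cell S \<beta> X d = e \<beta> d))"
  using \<gamma>
proof (cases rule: field_cases)
  case 1
  moreover from this have "\<not> is_succ lam \<beta> \<gamma>" for \<beta>
    using is_succD(1) unfolding is_zero_def by blast
  ultimately show ?thesis
    using initial Z zero_stage unfolding is_initial_def is_zero_def by simp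
next
  case (2 \<beta>)
  note \<beta> = is_succD[OF this]
  \<comment> \<open>Every \<alpha> below \<gamma> is \<le> \<beta>, so its link factors through
    stage \<beta> and its condition follows from the one at \<beta>. Uniqueness of the predecessor
    then collapses the quantifier over cells as well.\<close>
  have "(\<forall>\<alpha> \<in> underS lam \<gamma>. h \<cdot> link S \<alpha> \<gamma> X = m \<alpha>) \<longleftrightarrow> h \<cdot> link S \<beta> \<gamma> X = m \<beta>"
    if h: "h \<in> homs C (stage S \<gamma> X) Z" for h
  proof -
    have "h \<cdot> link S \<alpha> \<gamma> X = m \<alpha>" if "h \<cdot> link S \<beta> \<gamma> X = m \<beta>" "\<alpha> \<in> underS lam \<gamma>" for \<alpha>
      using comp_assoc[OF link_hom link_hom h, OF is_succ_below[OF 2 that(2)] \<beta>(2)] that(1)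
      by (simp add: ml[OF \<beta>(1)] link_link is_succ_below[OF 2 that(2)] \<beta>(2))
    then show ?thesis
      using \<beta>(1) by blast
  qed
  moreover have "(\<forall>\<beta>'. is_succ lam \<beta>' \<gamma> \<longrightarrow> P \<beta>') \<longleftrightarrow> P \<beta>" for P
    using 2 is_succ_unique by blast
  ultimately show ?thesis
    using succ_universal(2)[OF 2 m[OF \<beta>(1)] e[OF 2]] by (simp cong: conj_cong)
next
  case 3
  have sub: "underS lam \<gamma> \<subseteq> Field lam"
    by (auto simp: underS_def Field_def)
  have "is_colimit (ord_cat lam (underS lam \<gamma>)) C (stage_chain S X) (stage S \<gamma> X)
      (\<lambda>\<beta>. link S \<beta> \<gamma> X)"
    using chain 3 unfolding ord_sequence_def by (simp add: stage_chain_def)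
  moreover have "is_cocone (ord_cat lam (underS lam \<gamma>)) C (stage_chain S X) Z m"
    using Z m ml by (simp add: cocone_iff[OF sub])
  ultimately have "\<exists>!h. h \<in> homs C (stage S \<gamma> X) Z \<and>
      (\<forall>\<beta> \<in> underS lam \<gamma>. h \<cdot> link S \<beta> \<gamma> X = m \<beta>)"
    unfolding is_colimit_def by (simp add: ord_cat_def)
  moreover have "\<not> is_succ lam \<beta> \<gamma>" for \<beta>
    using 3 unfolding is_lim_def by blast
  ultimately show ?thesis
    by simp
qed

text \<open>The uniqueness half of \<open>stage_universal\<close>, for the data obtained by
  restricting \<open>f\<close>.\<close>

lemma stage_ext:
  assumes \<gamma>: "\<gamma> \<in> Field lam"
    and f: "f \<in> homs C (stage S \<gamma> X) Z" and g: "g \<in> homs C (stage S \<gamma> X) Z"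
    and l: "\<And>\<beta>. \<beta> \<in> underS lam \<gamma> \<Longrightarrow> f \<cdot> link S \<beta> \<gamma> X = g \<cdot> link S \<beta> \<gamma> X"
    and c: "\<And>\<beta> i a b. is_succ lam \<beta> \<gamma> \<Longrightarrow> (i, a, b) \<in> sq \<beta> X \<Longrightarrow>
      f \<cdot> cell S \<beta> X (i, a, b) = g \<cdot> cell S \<beta> X (i, a, b)"
  shows "f = g"
proof -
  have link: "link S \<beta> \<gamma> X \<in> homs C (stage S \<beta> X) (stage S \<gamma> X)" if "\<beta> \<in> underS lam \<gamma>" for \<beta>
    using that link_hom by (auto simp: underS_iff)
  have "\<exists>!h. h \<in> homs C (stage S \<gamma> X) Z \<and>
    (\<forall>\<beta> \<in> underS lam \<gamma>. h \<cdot> link S \<beta> \<gamma> X = f \<cdot> link S \<beta> \<gamma> X) \<and>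
    (\<forall>\<beta>. is_succ lam \<beta> \<gamma> \<longrightarrow> (\<forall>d \<in> sq \<beta> X. h \<cdot> cell S \<beta> X d = f \<cdot> cell S \<beta> X d))"
  proof (rule stage_universal[OF \<gamma> hom_obj(2)[OF f]])
    fix \<alpha> \<beta> assume "\<beta> \<in> underS lam \<gamma>" "(\<alpha>, \<beta>) \<in> lam"
    then show "(f \<cdot> link S \<beta> \<gamma> X) \<cdot> link S \<alpha> \<beta> X = f \<cdot> link S \<alpha> \<gamma> X"
      using comp_assoc[OF link_hom link f] link_link by (auto simp: underS_iff)
  next
    fix \<beta> i a b assume s: "is_succ lam \<beta> \<gamma>" and d: "(i, a, b) \<in> sq \<beta> X"
    note \<beta> = is_succD[OF s]
    note h = sq_homs[OF d aug_hom[OF \<beta>(3)]]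
    show "f \<cdot> cell S \<beta> X (i, a, b) \<in> homs C (Cod C (\<phi> i)) Z \<and>
      (f \<cdot> cell S \<beta> X (i, a, b)) \<cdot> \<phi> i = (f \<cdot> link S \<beta> \<gamma> X) \<cdot> a"
      using comp_hom[OF cell_hom[OF s d] f] comp_assoc[OF gen_hom[OF h(1)] cell_hom[OF s d] f]
        comp_assoc[OF h(2) link[OF \<beta>(1)] f] cell_gen[OF s d] by simp
  qed (use comp_hom[OF link f] in blast)
  then show ?thesis
    using f g l c by (metis (no_types, lifting) prod_cases3)
qed

text \<open>The induction principle behind all identities between stagewise families. Since both
  families satisfy the same law with \<tau>, agreement at earlier stages passes to the restrictions
  along links; only the cells at successors are left, where agreement at the predecessor may be
  used. Usually \<open>T\<close> and \<tau> are the stages and links of another object.\<close>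

lemma stage_eqI:
  assumes u: "\<And>\<beta>. \<beta> \<in> Field lam \<Longrightarrow> u \<beta> \<in> homs C (stage S \<beta> X) (T \<beta>)"
    and v: "\<And>\<beta>. \<beta> \<in> Field lam \<Longrightarrow> v \<beta> \<in> homs C (stage S \<beta> X) (T \<beta>)"
    and ul: "\<And>\<alpha> \<beta>. (\<alpha>, \<beta>) \<in> lam \<Longrightarrow> u \<beta> \<cdot> link S \<alpha> \<beta> X = \<tau> \<alpha> \<beta> \<cdot> u \<alpha>"
    and vl: "\<And>\<alpha> \<beta>. (\<alpha>, \<beta>) \<in> lam \<Longrightarrow> v \<beta> \<cdot> link S \<alpha> \<beta> X = \<tau> \<alpha> \<beta> \<cdot> v \<alpha>"
    and cell: "\<And>\<beta> \<gamma> i a b. is_succ lam \<beta> \<gamma> \<Longrightarrow> u \<beta> = v \<beta> \<Longrightarrow> (i, a, b) \<in> sq \<beta> X \<Longrightarrow>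
      u \<gamma> \<cdot> cell S \<beta> X (i, a, b) = v \<gamma> \<cdot> cell S \<beta> X (i, a, b)"
    and \<beta>: "\<beta> \<in> Field lam"
  shows "u \<beta> = v \<beta>"
  using lam_wf \<beta>
proof (induction \<beta> rule: wf_induct_rule)
  case (less \<gamma>)
  have eq: "u \<beta> = v \<beta>" if "\<beta> \<in> underS lam \<gamma>" for \<beta>
    using that less by (auto simp: underS_def Field_def)
  show ?case
  proof (rule stage_ext[OF less.prems u[OF less.prems] v[OF less.prems]])
    show "u \<gamma> \<cdot> link S \<beta> \<gamma> X = v \<gamma> \<cdot> link S \<beta> \<gamma> X" if "\<beta> \<in> underS lam \<gamma>" for \<beta>
      using that ul vl eq[OF that] by (auto simp: underS_iff)
  qed (use cell eq is_succD(1) in blast)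
qed

end

subsection \<open>Functoriality\<close>

context
  fixes X Y f
  assumes f: "f \<in> homs C X Y"
begin

lemma stage_map_hom: "\<beta> \<in> Field lam \<Longrightarrow> stage_map S \<beta> f \<in> homs C (stage S \<beta> X) (stage S \<beta> Y)"
  using soa f unfolding small_object_argument_def by blast

lemma stage_map_link:
  "(\<beta>, \<gamma>) \<in> lam \<Longrightarrow> stage_map S \<gamma> f \<cdot> link S \<beta> \<gamma> X = link S \<beta> \<gamma> Y \<cdot> stage_map S \<beta> f"
  using soa f unfolding small_object_argument_def by blast

lemma stage_map_cell:
  "is_succ lam \<beta> \<gamma> \<Longrightarrow> (i, a, b) \<in> sq \<beta> X \<Longrightarrow>
    stage_map S \<gamma> f \<cdot> cell S \<beta> X (i, a, b) = cell S \<beta> Y (i, stage_map S \<beta> f \<cdot> a, f \<cdot> b)"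
  using soa f unfolding small_object_argument_def by blast

lemma repl_hom: "ar (repl S) f \<in> homs C (SO X) (SO Y)"
  using soa f unfolding small_object_argument_def by blast

lemma repl_incl:
  "\<beta> \<in> Field lam \<Longrightarrow> ar (repl S) f \<cdot> incl S \<beta> X = incl S \<beta> Y \<cdot> stage_map S \<beta> f"
  using soa f unfolding small_object_argument_def by blast

text \<open>Naturality of the augmentation at \<beta> is a hypothesis here because
  \<open>aug_natural\<close> calls this lemma inside its own induction, with only the induction
  hypothesis at hand.\<close>

lemma sq_map:
  assumes \<beta>: "\<beta> \<in> Field lam" and nat: "aug S \<beta> Y \<cdot> stage_map S \<beta> f = f \<cdot> aug S \<beta> X"
    and d: "(i, a, b) \<in> sq \<beta> X"
  shows "(i, stage_map S \<beta> f \<cdot> a, f \<cdot> b) \<in> sq \<beta> Y"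
proof -
  note X = hom_obj(1)[OF f] and Y = hom_obj(2)[OF f]
  note h = sq_homs[OF d aug_hom[OF X \<beta>]]
  show ?thesis
  proof (rule sqI[OF h(1) _ _ _ aug_hom[OF Y \<beta>]])
    show "aug S \<beta> Y \<cdot> (stage_map S \<beta> f \<cdot> a) = f \<cdot> b \<cdot> \<phi> i"
      using comp_assoc[OF h(2) stage_map_hom[OF \<beta>] aug_hom[OF Y \<beta>]]
        comp_assoc[OF h(2) aug_hom[OF X \<beta>] f] comp_assoc[OF gen_hom[OF h(1)] h(3) f]
      by (simp add: nat h(4))
  qed (use h \<beta> comp_hom f stage_map_hom in blast)+
qed

text \<open>On the cell of (i, a, b) both sides equal \<open>f \<cdot> b\<close>. For the left side
  the induction hypothesis is needed first, to know that the image triple is a square and thus that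
  \<open>aug_cell\<close> applies to it.\<close>

lemma aug_natural:
  assumes "\<beta> \<in> Field lam"
  shows "aug S \<beta> Y \<cdot> stage_map S \<beta> f = f \<cdot> aug S \<beta> X"
proof -
  note X = hom_obj(1)[OF f] and Y = hom_obj(2)[OF f]
  \<comment> \<open>The target does not vary with the stage, so \<open>stage_eqI\<close> is used
    with the constant chain at \<open>Y\<close>, whose links are identities. These equations remove
    them.\<close>
  have eq: "Ide C Y \<cdot> (aug S \<beta> Y \<cdot> stage_map S \<beta> f) = aug S \<beta> Y \<cdot> stage_map S \<beta> f"
    "Ide C Y \<cdot> (f \<cdot> aug S \<beta> X) = f \<cdot> aug S \<beta> X" if "\<beta> \<in> Field lam" for \<beta>
    using comp_id(2) comp_hom[OF stage_map_hom aug_hom[OF Y]] comp_hom[OF aug_hom[OF X] f] that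
    by blast+
  show ?thesis
  proof (rule stage_eqI[OF X, where T = "\<lambda>_. Y" and \<tau> = "\<lambda>_ _. Ide C Y"])
    fix \<alpha> \<beta> assume l: "(\<alpha>, \<beta>) \<in> lam"
    show "(aug S \<beta> Y \<cdot> stage_map S \<beta> f) \<cdot> link S \<alpha> \<beta> X =
        Ide C Y \<cdot> (aug S \<alpha> Y \<cdot> stage_map S \<alpha> f)"
      unfolding eq[OF lam_field(1)[OF l]]
      using comp_assoc[OF link_hom[OF X l] stage_map_hom[OF lam_field(2)[OF l]] aug_hom[OF Y lam_field(2)[OF l]]]
        comp_assoc[OF stage_map_hom[OF lam_field(1)[OF l]] link_hom[OF Y l] aug_hom[OF Y lam_field(2)[OF l]]]
      by (simp add: stage_map_link[OF l] aug_link[OF Y l])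
    show "(f \<cdot> aug S \<beta> X) \<cdot> link S \<alpha> \<beta> X = Ide C Y \<cdot> (f \<cdot> aug S \<alpha> X)"
      unfolding eq[OF lam_field(1)[OF l]]
      using comp_assoc[OF link_hom[OF X l] aug_hom[OF X lam_field(2)[OF l]] f]
      by (simp add: aug_link[OF X l])
  next
    fix \<beta> \<gamma> i a b
    assume s: "is_succ lam \<beta> \<gamma>" and IH: "aug S \<beta> Y \<cdot> stage_map S \<beta> f = f \<cdot> aug S \<beta> X"
      and d: "(i, a, b) \<in> sq \<beta> X"
    note \<beta> = is_succD[OF s]
    note d' = sq_map[OF \<beta>(3) IH d]
    show "(aug S \<gamma> Y \<cdot> stage_map S \<gamma> f) \<cdot> cell S \<beta> X (i, a, b) =
        (f \<cdot> aug S \<gamma> X) \<cdot> cell S \<beta> X (i, a, b)"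
      using comp_assoc[OF cell_hom[OF X s d] stage_map_hom[OF \<beta>(4)] aug_hom[OF Y \<beta>(4)]]
        comp_assoc[OF cell_hom[OF X s d] aug_hom[OF X \<beta>(4)] f]
      by (simp add: stage_map_cell[OF s d] aug_cell[OF X s d] aug_cell[OF Y s d'])
  qed (use assms comp_hom stage_map_hom aug_hom[OF X] aug_hom[OF Y] f in blast)+
qed

lemma counit_natural: "counit S Y \<cdot> ar (repl S) f = f \<cdot> counit S X"
proof (rule repl_eqI)
  note X = hom_obj(1)[OF f] and Y = hom_obj(2)[OF f]
  show "X \<in> Obj C" by (rule X)
  show "counit S Y \<cdot> ar (repl S) f \<in> homs C (SO X) Y" "f \<cdot> counit S X \<in> homs C (SO X) Y"
    using comp_hom repl_hom counit_hom X Y f by blast+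
  fix \<beta> assume \<beta>: "\<beta> \<in> Field lam"
  show "(counit S Y \<cdot> ar (repl S) f) \<cdot> incl S \<beta> X = (f \<cdot> counit S X) \<cdot> incl S \<beta> X"
    using comp_assoc[OF incl_hom[OF X \<beta>] repl_hom counit_hom[OF Y]]
      comp_assoc[OF incl_hom[OF X \<beta>] counit_hom[OF X] f]
      comp_assoc[OF stage_map_hom[OF \<beta>] incl_hom[OF Y \<beta>] counit_hom[OF Y]]
    by (simp add: repl_incl[OF \<beta>] counit_incl[OF X \<beta>] counit_incl[OF Y \<beta>] aug_natural[OF \<beta>])
qed

end

text \<open>Functor laws are not built into \<open>small_object_argument\<close>. They follow
  because its equations determine the action on maps, and the identity satisfies them.\<close>

lemma stage_map_id:
  assumes X: "X \<in> Obj C" and "\<beta> \<in> Field lam"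
  shows "stage_map S \<beta> (Ide C X) = Ide C (stage S \<beta> X)"
proof (rule stage_eqI[OF X, where T = "\<lambda>\<beta>. stage S \<beta> X" and \<tau> = "\<lambda>\<alpha> \<beta>. link S \<alpha> \<beta> X"])
  show "Ide C (stage S \<beta> X) \<cdot> link S \<alpha> \<beta> X = link S \<alpha> \<beta> X \<cdot> Ide C (stage S \<alpha> X)"
    if "(\<alpha>, \<beta>) \<in> lam" for \<alpha> \<beta>
    using comp_id[OF link_hom[OF X that]] by simp
next
  fix \<beta> \<gamma> i a b
  assume s: "is_succ lam \<beta> \<gamma>" and IH: "stage_map S \<beta> (Ide C X) = Ide C (stage S \<beta> X)"
    and d: "(i, a, b) \<in> sq \<beta> X"
  note \<beta> = is_succD[OF s]
  note h = sq_homs[OF d aug_hom[OF X \<beta>(3)]]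
  show "stage_map S \<gamma> (Ide C X) \<cdot> cell S \<beta> X (i, a, b) =
      Ide C (stage S \<gamma> X) \<cdot> cell S \<beta> X (i, a, b)"
    using comp_id(2)[OF cell_hom[OF X s d]] comp_id(2)[OF h(2)] comp_id(2)[OF h(3)]
    by (simp add: stage_map_cell[OF id_hom[OF X] s d] IH)
qed (use assms stage_map_hom id_hom stage_obj stage_map_link in blast)+

lemma stage_map_comp:
  assumes f: "f \<in> homs C X Y" and g: "g \<in> homs C Y Z" and "\<beta> \<in> Field lam"
  shows "stage_map S \<beta> (g \<cdot> f) = stage_map S \<beta> g \<cdot> stage_map S \<beta> f"
proof -
  note X = hom_obj(1)[OF f] and Y = hom_obj(2)[OF f] and Z = hom_obj(2)[OF g]
  note gf = comp_hom[OF f g]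
  show ?thesis
  proof (rule stage_eqI[OF X, where T = "\<lambda>\<beta>. stage S \<beta> Z" and \<tau> = "\<lambda>\<alpha> \<beta>. link S \<alpha> \<beta> Z"])
    fix \<alpha> \<beta> assume l: "(\<alpha>, \<beta>) \<in> lam"
    note \<alpha> = lam_field(1)[OF l] and \<beta> = lam_field(2)[OF l]
    show "(stage_map S \<beta> g \<cdot> stage_map S \<beta> f) \<cdot> link S \<alpha> \<beta> X =
        link S \<alpha> \<beta> Z \<cdot> (stage_map S \<alpha> g \<cdot> stage_map S \<alpha> f)"
      using comp_assoc[OF link_hom[OF X l] stage_map_hom[OF f \<beta>] stage_map_hom[OF g \<beta>]]
        comp_assoc[OF stage_map_hom[OF f \<alpha>] link_hom[OF Y l] stage_map_hom[OF g \<beta>]]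
        comp_assoc[OF stage_map_hom[OF f \<alpha>] stage_map_hom[OF g \<alpha>] link_hom[OF Z l]]
      by (simp add: stage_map_link[OF f l] stage_map_link[OF g l])
  next
    fix \<beta> \<gamma> i a b
    assume s: "is_succ lam \<beta> \<gamma>"
      and IH: "stage_map S \<beta> (g \<cdot> f) = stage_map S \<beta> g \<cdot> stage_map S \<beta> f"
      and d: "(i, a, b) \<in> sq \<beta> X"
    note \<beta> = is_succD[OF s]
    note h = sq_homs[OF d aug_hom[OF X \<beta>(3)]]
    \<comment> \<open>The equation for \<open>g\<close> on cells can be applied only once the image
      of the square under \<open>f\<close> is known to be a square over \<open>Y\<close>.\<close>
    note d' = sq_map[OF f \<beta>(3) aug_natural[OF f \<beta>(3)] d]
    show "stage_map S \<gamma> (g \<cdot> f) \<cdot> cell S \<beta> X (i, a, b) =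
        (stage_map S \<gamma> g \<cdot> stage_map S \<gamma> f) \<cdot> cell S \<beta> X (i, a, b)"
      using comp_assoc[OF h(2) stage_map_hom[OF f \<beta>(3)] stage_map_hom[OF g \<beta>(3)]]
        comp_assoc[OF h(3) f g]
        comp_assoc[OF cell_hom[OF X s d] stage_map_hom[OF f \<beta>(4)] stage_map_hom[OF g \<beta>(4)]]
      by (simp add: stage_map_cell[OF gf s d] stage_map_cell[OF f s d]
          stage_map_cell[OF g s d'] IH)
  qed (use assms stage_map_hom stage_map_link comp_hom in blast)+
qed

lemma repl_functor: "is_functor C C (repl S)"
  unfolding is_functor_def
proof (intro conjI allI ballI)
  fix X assume X: "X \<in> Obj C"
  show "SO X \<in> Obj C"
    by (rule repl_obj[OF X])
  show "ar (repl S) (Ide C X) = Ide C (SO X)"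
  proof (rule repl_eqI[OF X repl_hom[OF id_hom[OF X]] id_hom[OF repl_obj[OF X]]])
    fix \<beta> assume \<beta>: "\<beta> \<in> Field lam"
    show "ar (repl S) (Ide C X) \<cdot> incl S \<beta> X = Ide C (SO X) \<cdot> incl S \<beta> X"
      using comp_id[OF incl_hom[OF X \<beta>]]
      by (simp add: repl_incl[OF id_hom[OF X] \<beta>] stage_map_id[OF X \<beta>])
  qed
next
  fix X Y Z f g assume f: "f \<in> homs C X Y" and g: "g \<in> homs C Y Z"
  note X = hom_obj(1)[OF f] and Y = hom_obj(2)[OF f] and Z = hom_obj(2)[OF g]
  note gf = comp_hom[OF f g]
  show "ar (repl S) (g \<cdot> f) = ar (repl S) g \<cdot> ar (repl S) f"
  proof (rule repl_eqI[OF X repl_hom[OF gf] comp_hom[OF repl_hom[OF f] repl_hom[OF g]]])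
    fix \<beta> assume \<beta>: "\<beta> \<in> Field lam"
    show "ar (repl S) (g \<cdot> f) \<cdot> incl S \<beta> X = (ar (repl S) g \<cdot> ar (repl S) f) \<cdot> incl S \<beta> X"
      using comp_assoc[OF incl_hom[OF X \<beta>] repl_hom[OF f] repl_hom[OF g]]
        comp_assoc[OF stage_map_hom[OF f \<beta>] incl_hom[OF Y \<beta>] repl_hom[OF g]]
        comp_assoc[OF stage_map_hom[OF f \<beta>] stage_map_hom[OF g \<beta>] incl_hom[OF Z \<beta>]]
      by (simp add: repl_incl[OF f \<beta>] repl_incl[OF g \<beta>] repl_incl[OF gf \<beta>]
          stage_map_comp[OF f g \<beta>])
  qed
qed (use category repl_hom in blast)+

subsection \<open>The comultiplication\<close>

text \<open>Only values of \<delta> strictly below \<gamma> enter, as well-founded recursion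
  requires. A cell attached to stage \<beta> lands in the next stage, hence the third entry uses
  \<open>incl S \<gamma> X\<close> and not \<open>incl S \<beta> X\<close>.\<close>

definition comult_step :: "'o \<Rightarrow> 'u \<Rightarrow> ('u \<Rightarrow> 'm) \<Rightarrow> 'm \<Rightarrow> bool" where
  "comult_step X \<gamma> \<delta> h \<longleftrightarrow>
     h \<in> homs C (stage S \<gamma> X) (stage S \<gamma> (SO X)) \<and>
     (\<forall>\<beta> \<in> underS lam \<gamma>. h \<cdot> link S \<beta> \<gamma> X = link S \<beta> \<gamma> (SO X) \<cdot> \<delta> \<beta>) \<and>
     (\<forall>\<beta>. is_succ lam \<beta> \<gamma> \<longrightarrow> (\<forall>d \<in> sq \<beta> X. h \<cdot> cell S \<beta> X d =
        (case d of (i, a, b) \<Rightarrow> cell S \<beta> (SO X) (i, \<delta> \<beta> \<cdot> a, incl S \<gamma> X \<cdot> cell S \<beta> X d))))"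

text \<open>A choice operator, because the existence of a suitable map can be shown only together
  with properties of the earlier values; see \<open>comult_stage_step\<close>.\<close>

definition comult_stage :: "'o \<Rightarrow> 'u \<Rightarrow> 'm" where
  "comult_stage X = wfrec (lam - Id) (\<lambda>\<delta> \<gamma>. SOME h. comult_step X \<gamma> \<delta> h)"

definition comult :: "'o \<Rightarrow> 'm" where
  "comult X = (SOME h. h \<in> homs C (SO X) (SO (SO X)) \<and>
     (\<forall>\<beta> \<in> Field lam. h \<cdot> incl S \<beta> X = incl S \<beta> (SO X) \<cdot> comult_stage X \<beta>))"

text \<open>The cut in the recursion is harmless: \<open>comult_step\<close> evaluates \<delta> only
  below \<gamma>, and a predecessor of \<gamma> lies below \<gamma>.\<close>

lemma comult_stage_rec:
  "comult_stage X \<gamma> = (SOME h. comult_step X \<gamma> (comult_stage X) h)"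
proof -
  let ?c = "cut (comult_stage X) (lam - Id) \<gamma>"
  have "?c \<beta> = comult_stage X \<beta>" if "\<beta> \<in> underS lam \<gamma>" for \<beta>
    using that by (simp add: underS_iff cut_apply)
  then have "comult_step X \<gamma> ?c = comult_step X \<gamma> (comult_stage X)"
    using is_succD(1) unfolding comult_step_def by (intro ext) (simp cong: conj_cong)
  then show ?thesis
    unfolding comult_stage_def by (subst wfrec[OF lam_wf]) simp
qed

section \<open>Existence of the comultiplication\<close>

context
  fixes X
  assumes X: "X \<in> Obj C"
begin

private lemmas SX = repl_obj[OF X]

text \<open>Both ways around the square equal the inclusion of stage \<gamma> after the link after
  \<open>a\<close>: one by \<open>ah\<close>, the other because the cell restricts along
  \<open>\<phi> i\<close> to the link after \<open>a\<close>. The map \<open>h\<close> is arbitrary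
  so that the lemma applies during the recursion too.\<close>

lemma comult_sq:
  assumes s: "is_succ lam \<beta> \<gamma>" and h: "h \<in> homs C (stage S \<beta> X) (stage S \<beta> (SO X))"
    and ah: "aug S \<beta> (SO X) \<cdot> h = incl S \<beta> X" and d: "(i, a, b) \<in> sq \<beta> X"
  shows "(i, h \<cdot> a, incl S \<gamma> X \<cdot> cell S \<beta> X (i, a, b)) \<in> sq \<beta> (SO X)"
proof -
  note \<beta> = is_succD[OF s]
  note q = sq_homs[OF d aug_hom[OF X \<beta>(3)]] and c = cell_hom[OF X s d]
  have "aug S \<beta> (SO X) \<cdot> (h \<cdot> a) = (incl S \<gamma> X \<cdot> link S \<beta> \<gamma> X) \<cdot> a"
    using comp_assoc[OF q(2) h aug_hom[OF SX \<beta>(3)]] ah incl_link[OF X \<beta>(2)] by simp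
  also have "\<dots> = (incl S \<gamma> X \<cdot> cell S \<beta> X (i, a, b)) \<cdot> \<phi> i"
    using comp_assoc[OF q(2) link_hom[OF X \<beta>(2)] incl_hom[OF X \<beta>(4)]]
      comp_assoc[OF gen_hom[OF q(1)] c incl_hom[OF X \<beta>(4)]] cell_gen[OF X s d] by simp
  finally show ?thesis
    using sqI[OF q(1) comp_hom[OF q(2) h] comp_hom[OF c incl_hom[OF X \<beta>(4)]] _
        aug_hom[OF SX \<beta>(3)]] by blast
qed

text \<open>The claims support each other. The augmentation identity at \<beta> makes the prescribed
  triples squares, so the cells needed at the successor exist; the map obtained there in turn
  satisfies the augmentation identity.\<close>

lemma comult_stage_step:
  assumes "\<gamma> \<in> Field lam"
  shows "comult_step X \<gamma> (comult_stage X) (comult_stage X \<gamma>) \<and>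
    aug S \<gamma> (SO X) \<cdot> comult_stage X \<gamma> = incl S \<gamma> X"
  using lam_wf assms
proof (induction \<gamma> rule: wf_induct_rule)
  case (less \<gamma>)
  let ?\<delta> = "comult_stage X"
  let ?e = "\<lambda>\<beta> d. case d of (i, a, b) \<Rightarrow>
    cell S \<beta> (SO X) (i, ?\<delta> \<beta> \<cdot> a, incl S \<gamma> X \<cdot> cell S \<beta> X d)"
  note \<gamma> = less.prems
  have lt: "(\<beta>, \<gamma>) \<in> lam" "\<beta> \<in> Field lam" if "\<beta> \<in> underS lam \<gamma>" for \<beta>
    using that by (auto simp: underS_def Field_def)
  have step: "comult_step X \<beta> ?\<delta> (?\<delta> \<beta>)" and aug: "aug S \<beta> (SO X) \<cdot> ?\<delta> \<beta> = incl S \<beta> X"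
    if "\<beta> \<in> underS lam \<gamma>" for \<beta>
    using less that lt(2) underS_iff by blast+
  have \<delta>: "?\<delta> \<beta> \<in> homs C (stage S \<beta> X) (stage S \<beta> (SO X))" if "\<beta> \<in> underS lam \<gamma>" for \<beta>
    using step[OF that] unfolding comult_step_def by blast
  \<comment> \<open>\<open>comult_step\<close> constrains only strictly smaller stages; the
    reflexive case comes from identity links.\<close>
  have \<delta>l: "?\<delta> \<beta> \<cdot> link S \<alpha> \<beta> X = link S \<alpha> \<beta> (SO X) \<cdot> ?\<delta> \<alpha>"
    if "\<beta> \<in> underS lam \<gamma>" "(\<alpha>, \<beta>) \<in> lam" for \<alpha> \<beta>
  proof (cases "\<alpha> = \<beta>")
    case True
    then show ?thesis
      using comp_id[OF \<delta>[OF that(1)]] link_id[OF X] link_id[OF SX] lt(2)[OF that(1)] by simp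
  next
    case False
    then show ?thesis
      using step[OF that(1)] that(2) unfolding comult_step_def by (simp add: underS_iff)
  qed
  have "\<exists>!h. comult_step X \<gamma> ?\<delta> h"
    unfolding comult_step_def
  proof (rule stage_universal[OF X \<gamma> stage_obj[OF SX \<gamma>]])
    show "link S \<beta> \<gamma> (SO X) \<cdot> ?\<delta> \<beta> \<in> homs C (stage S \<beta> X) (stage S \<gamma> (SO X))"
      if "\<beta> \<in> underS lam \<gamma>" for \<beta>
      using comp_hom \<delta> link_hom[OF SX] lt that by blast
  next
    fix \<alpha> \<beta> assume u: "\<beta> \<in> underS lam \<gamma>" and l: "(\<alpha>, \<beta>) \<in> lam"
    then have u': "\<alpha> \<in> underS lam \<gamma>"
      using lam_trans lam_antisym by (auto simp: underS_iff)
    show "(link S \<beta> \<gamma> (SO X) \<cdot> ?\<delta> \<beta>) \<cdot> link S \<alpha> \<beta> X = link S \<alpha> \<gamma> (SO X) \<cdot> ?\<delta> \<alpha>"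
      using comp_assoc[OF link_hom[OF X l] \<delta>[OF u] link_hom[OF SX lt(1)[OF u]]]
        comp_assoc[OF \<delta>[OF u'] link_hom[OF SX l] link_hom[OF SX lt(1)[OF u]]]
      by (simp add: \<delta>l[OF u l] link_link[OF SX l lt(1)[OF u]])
  next
    fix \<beta> i a b assume s: "is_succ lam \<beta> \<gamma>" and d: "(i, a, b) \<in> sq \<beta> X"
    note \<beta> = is_succD[OF s]
    note q = sq_homs[OF d aug_hom[OF X \<beta>(3)]]
    note d' = comult_sq[OF s \<delta>[OF \<beta>(1)] aug[OF \<beta>(1)] d]
    show "?e \<beta> (i, a, b) \<in> homs C (Cod C (\<phi> i)) (stage S \<gamma> (SO X)) \<and>
      ?e \<beta> (i, a, b) \<cdot> \<phi> i = (link S \<beta> \<gamma> (SO X) \<cdot> ?\<delta> \<beta>) \<cdot> a"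
      using cell_hom[OF SX s d'] cell_gen[OF SX s d']
        comp_assoc[OF q(2) \<delta>[OF \<beta>(1)] link_hom[OF SX \<beta>(2)]] by simp
  qed
  then have st: "comult_step X \<gamma> ?\<delta> (?\<delta> \<gamma>)"
    unfolding comult_stage_rec[of X \<gamma>] by (rule someI_ex[OF ex1_implies_ex])
  then have h: "?\<delta> \<gamma> \<in> homs C (stage S \<gamma> X) (stage S \<gamma> (SO X))"
    unfolding comult_step_def by blast
  have "aug S \<gamma> (SO X) \<cdot> ?\<delta> \<gamma> = incl S \<gamma> X"
  proof (rule stage_ext[OF X \<gamma> comp_hom[OF h aug_hom[OF SX \<gamma>]] incl_hom[OF X \<gamma>]])
    fix \<beta> assume u: "\<beta> \<in> underS lam \<gamma>"
    note l = lt(1)[OF u]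
    have "?\<delta> \<gamma> \<cdot> link S \<beta> \<gamma> X = link S \<beta> \<gamma> (SO X) \<cdot> ?\<delta> \<beta>"
      using st u unfolding comult_step_def by blast
    then show "(aug S \<gamma> (SO X) \<cdot> ?\<delta> \<gamma>) \<cdot> link S \<beta> \<gamma> X = incl S \<gamma> X \<cdot> link S \<beta> \<gamma> X"
      using comp_assoc[OF link_hom[OF X l] h aug_hom[OF SX \<gamma>]]
        comp_assoc[OF \<delta>[OF u] link_hom[OF SX l] aug_hom[OF SX \<gamma>]]
      by (simp add: aug_link[OF SX l] incl_link[OF X l] aug[OF u])
  next
    fix \<beta> i a b assume s: "is_succ lam \<beta> \<gamma>" and d: "(i, a, b) \<in> sq \<beta> X"
    note \<beta> = is_succD[OF s]
    note d' = comult_sq[OF s \<delta>[OF \<beta>(1)] aug[OF \<beta>(1)] d]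
    \<comment> \<open>The augmentation returns the third entry of a square on its cell, and that
      entry is the inclusion after the original cell, as required.\<close>
    have "?\<delta> \<gamma> \<cdot> cell S \<beta> X (i, a, b) =
        cell S \<beta> (SO X) (i, ?\<delta> \<beta> \<cdot> a, incl S \<gamma> X \<cdot> cell S \<beta> X (i, a, b))"
      using st s d unfolding comult_step_def by auto
    then show "(aug S \<gamma> (SO X) \<cdot> ?\<delta> \<gamma>) \<cdot> cell S \<beta> X (i, a, b) =
        incl S \<gamma> X \<cdot> cell S \<beta> X (i, a, b)"
      using comp_assoc[OF cell_hom[OF X s d] h aug_hom[OF SX \<gamma>]] aug_cell[OF SX s d'] by simp
  qed
  then show ?case
    using st by blast
qed

lemma comult_stage_hom:
  "\<beta> \<in> Field lam \<Longrightarrow> comult_stage X \<beta> \<in> homs C (stage S \<beta> X) (stage S \<beta> (SO X))"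
  using comult_stage_step unfolding comult_step_def by blast

lemma aug_comult_stage: "\<beta> \<in> Field lam \<Longrightarrow> aug S \<beta> (SO X) \<cdot> comult_stage X \<beta> = incl S \<beta> X"
  using comult_stage_step by blast

lemma comult_stage_link:
  assumes "(\<alpha>, \<beta>) \<in> lam"
  shows "comult_stage X \<beta> \<cdot> link S \<alpha> \<beta> X = link S \<alpha> \<beta> (SO X) \<cdot> comult_stage X \<alpha>"
proof -
  note \<beta> = lam_field(2)[OF assms]
  show ?thesis
  proof (cases "\<alpha> = \<beta>")
    case True
    then show ?thesis
      using comp_id[OF comult_stage_hom[OF \<beta>]] link_id[OF X \<beta>] link_id[OF SX \<beta>] by simp
  next
    case False
    then show ?thesis
      using comult_stage_step[OF \<beta>] assms unfolding comult_step_def by (simp add: underS_iff)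
  qed
qed

lemma comult_stage_cell:
  assumes "is_succ lam \<beta> \<gamma>" "(i, a, b) \<in> sq \<beta> X"
  shows "comult_stage X \<gamma> \<cdot> cell S \<beta> X (i, a, b) =
    cell S \<beta> (SO X) (i, comult_stage X \<beta> \<cdot> a, incl S \<gamma> X \<cdot> cell S \<beta> X (i, a, b))"
  using comult_stage_step[OF is_succD(4)[OF assms(1)]] assms unfolding comult_step_def by auto

lemma comult_spec:
  "comult X \<in> homs C (SO X) (SO (SO X)) \<and>
   (\<forall>\<beta> \<in> Field lam. comult X \<cdot> incl S \<beta> X = incl S \<beta> (SO X) \<cdot> comult_stage X \<beta>)"
proof -
  have "\<exists>h \<in> homs C (SO X) (SO (SO X)).
      \<forall>\<beta> \<in> Field lam. h \<cdot> incl S \<beta> X = incl S \<beta> (SO X) \<cdot> comult_stage X \<beta>"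
  proof (rule repl_ex[OF X repl_obj[OF SX]])
    fix \<alpha> \<beta> assume l: "(\<alpha>, \<beta>) \<in> lam"
    note F = lam_field[OF l]
    show "(incl S \<beta> (SO X) \<cdot> comult_stage X \<beta>) \<cdot> link S \<alpha> \<beta> X =
        incl S \<alpha> (SO X) \<cdot> comult_stage X \<alpha>"
      using comp_assoc[OF link_hom[OF X l] comult_stage_hom[OF F(2)] incl_hom[OF SX F(2)]]
        comp_assoc[OF comult_stage_hom[OF F(1)] link_hom[OF SX l] incl_hom[OF SX F(2)]]
      by (simp add: comult_stage_link[OF l] incl_link[OF SX l])
  qed (use comp_hom comult_stage_hom incl_hom[OF SX] in blast)
  then show ?thesis
    unfolding comult_def Bex_def by (rule someI_ex)
qed

lemma comult_hom: "comult X \<in> homs C (SO X) (SO (SO X))"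
  using comult_spec by blast

lemma comult_incl:
  "\<beta> \<in> Field lam \<Longrightarrow> comult X \<cdot> incl S \<beta> X = incl S \<beta> (SO X) \<cdot> comult_stage X \<beta>"
  using comult_spec by blast

section \<open>The two counit laws\<close>

lemma counit_comult: "counit S (SO X) \<cdot> comult X = Ide C (SO X)"
proof (rule repl_eqI[OF X comp_hom[OF comult_hom counit_hom[OF SX]] id_hom[OF SX]])
  fix \<beta> assume \<beta>: "\<beta> \<in> Field lam"
  \<comment> \<open>The counit restricts to the augmentation on each stage, so the law is the
    statement that \<open>comult_stage\<close> lies over the inclusion.\<close>
  show "(counit S (SO X) \<cdot> comult X) \<cdot> incl S \<beta> X = Ide C (SO X) \<cdot> incl S \<beta> X"
    by (simp add: comp_assoc[OF incl_hom[OF X \<beta>] comult_hom counit_hom[OF SX]]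
        comp_assoc[OF comult_stage_hom[OF \<beta>] incl_hom[OF SX \<beta>] counit_hom[OF SX], symmetric]
        comult_incl[OF \<beta>] counit_incl[OF SX \<beta>] aug_comult_stage[OF \<beta>]
        comp_id(2)[OF incl_hom[OF X \<beta>]])
qed

text \<open>Applied to the cell of (i, a, b), the composite gives the cell named by the images of
  both maps. The induction hypothesis returns \<open>a\<close>, and \<epsilon> after the inclusion
  is the augmentation, which returns \<open>b\<close> on the cell: the original name is
  recovered.\<close>

lemma stage_map_counit_comult_stage:
  assumes "\<beta> \<in> Field lam"
  shows "stage_map S \<beta> (counit S X) \<cdot> comult_stage X \<beta> = Ide C (stage S \<beta> X)"
proof (rule stage_eqI[OF X, where T = "\<lambda>\<beta>. stage S \<beta> X" and \<tau> = "\<lambda>\<alpha> \<beta>. link S \<alpha> \<beta> X"])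
  note \<epsilon> = counit_hom[OF X]
  note sm = stage_map_hom[OF \<epsilon>]
  show "stage_map S \<beta> (counit S X) \<cdot> comult_stage X \<beta> \<in> homs C (stage S \<beta> X) (stage S \<beta> X)"
    if "\<beta> \<in> Field lam" for \<beta>
    using comp_hom[OF comult_stage_hom[OF that] sm[OF that]] .
  show "Ide C (stage S \<beta> X) \<in> homs C (stage S \<beta> X) (stage S \<beta> X)" if "\<beta> \<in> Field lam" for \<beta>
    using id_hom[OF stage_obj[OF X that]] .
  {
    fix \<alpha> \<beta> assume l: "(\<alpha>, \<beta>) \<in> lam"
    note F = lam_field[OF l]
    show "(stage_map S \<beta> (counit S X) \<cdot> comult_stage X \<beta>) \<cdot> link S \<alpha> \<beta> X =
        link S \<alpha> \<beta> X \<cdot> (stage_map S \<alpha> (counit S X) \<cdot> comult_stage X \<alpha>)"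
      using comp_assoc[OF link_hom[OF X l] comult_stage_hom[OF F(2)] sm[OF F(2)]]
        comp_assoc[OF comult_stage_hom[OF F(1)] link_hom[OF SX l] sm[OF F(2)]]
        comp_assoc[OF comult_stage_hom[OF F(1)] sm[OF F(1)] link_hom[OF X l]]
      by (simp add: comult_stage_link[OF l] stage_map_link[OF \<epsilon> l])
    show "Ide C (stage S \<beta> X) \<cdot> link S \<alpha> \<beta> X = link S \<alpha> \<beta> X \<cdot> Ide C (stage S \<alpha> X)"
      using comp_id[OF link_hom[OF X l]] by simp
  }
  fix \<beta> \<gamma> i a b
  assume s: "is_succ lam \<beta> \<gamma>" and d: "(i, a, b) \<in> sq \<beta> X"
    and IH: "stage_map S \<beta> (counit S X) \<cdot> comult_stage X \<beta> = Ide C (stage S \<beta> X)"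
  note \<beta> = is_succD[OF s]
  note q = sq_homs[OF d aug_hom[OF X \<beta>(3)]] and c = cell_hom[OF X s d]
  note d' = comult_sq[OF s comult_stage_hom[OF \<beta>(3)] aug_comult_stage[OF \<beta>(3)] d]
  have "stage_map S \<beta> (counit S X) \<cdot> (comult_stage X \<beta> \<cdot> a) = a"
    using comp_assoc[OF q(2) comult_stage_hom[OF \<beta>(3)] sm[OF \<beta>(3)]] comp_id(2)[OF q(2)]
    by (simp add: IH)
  moreover have "counit S X \<cdot> (incl S \<gamma> X \<cdot> cell S \<beta> X (i, a, b)) = b"
    using comp_assoc[OF c incl_hom[OF X \<beta>(4)] \<epsilon>] aug_cell[OF X s d]
    by (simp add: counit_incl[OF X \<beta>(4)])
  ultimately show "(stage_map S \<gamma> (counit S X) \<cdot> comult_stage X \<gamma>) \<cdot> cell S \<beta> X (i, a, b) =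
      Ide C (stage S \<gamma> X) \<cdot> cell S \<beta> X (i, a, b)"
    using comp_assoc[OF c comult_stage_hom[OF \<beta>(4)] sm[OF \<beta>(4)]] comp_id(2)[OF c]
    by (simp add: comult_stage_cell[OF s d] stage_map_cell[OF \<epsilon> s d'])
qed (rule assms)

lemma repl_counit_comult: "ar (repl S) (counit S X) \<cdot> comult X = Ide C (SO X)"
proof (rule repl_eqI[OF X comp_hom[OF comult_hom repl_hom[OF counit_hom[OF X]]] id_hom[OF SX]])
  fix \<beta> assume \<beta>: "\<beta> \<in> Field lam"
  note \<epsilon> = counit_hom[OF X]
  show "(ar (repl S) (counit S X) \<cdot> comult X) \<cdot> incl S \<beta> X = Ide C (SO X) \<cdot> incl S \<beta> X"
    by (simp add: comp_assoc[OF incl_hom[OF X \<beta>] comult_hom repl_hom[OF \<epsilon>]]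
        comp_assoc[OF comult_stage_hom[OF \<beta>] incl_hom[OF SX \<beta>] repl_hom[OF \<epsilon>], symmetric]
        comp_assoc[OF comult_stage_hom[OF \<beta>] stage_map_hom[OF \<epsilon> \<beta>] incl_hom[OF X \<beta>]]
        comult_incl[OF \<beta>] repl_incl[OF \<epsilon> \<beta>] stage_map_counit_comult_stage[OF \<beta>]
        comp_id[OF incl_hom[OF X \<beta>]])
qed

end

section \<open>Naturality of the comultiplication\<close>

lemma comult_stage_natural:
  assumes f: "f \<in> homs C X Y" and "\<beta> \<in> Field lam"
  shows "comult_stage Y \<beta> \<cdot> stage_map S \<beta> f = stage_map S \<beta> (ar (repl S) f) \<cdot> comult_stage X \<beta>"
proof -
  note X = hom_obj(1)[OF f] and Y = hom_obj(2)[OF f]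
  note SX = repl_obj[OF X] and SY = repl_obj[OF Y] and Sf = repl_hom[OF f]
  note \<delta>X = comult_stage_hom[OF X] and \<delta>Y = comult_stage_hom[OF Y]
  note sf = stage_map_hom[OF f] and sSf = stage_map_hom[OF Sf]
  show ?thesis
  proof (rule stage_eqI[OF X, where T = "\<lambda>\<beta>. stage S \<beta> (SO Y)"
        and \<tau> = "\<lambda>\<alpha> \<beta>. link S \<alpha> \<beta> (SO Y)"])
    fix \<alpha> \<beta> assume l: "(\<alpha>, \<beta>) \<in> lam"
    note F = lam_field[OF l]
    show "(comult_stage Y \<beta> \<cdot> stage_map S \<beta> f) \<cdot> link S \<alpha> \<beta> X =
        link S \<alpha> \<beta> (SO Y) \<cdot> (comult_stage Y \<alpha> \<cdot> stage_map S \<alpha> f)"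
      using comp_assoc[OF link_hom[OF X l] sf[OF F(2)] \<delta>Y[OF F(2)]]
        comp_assoc[OF sf[OF F(1)] link_hom[OF Y l] \<delta>Y[OF F(2)]]
        comp_assoc[OF sf[OF F(1)] \<delta>Y[OF F(1)] link_hom[OF SY l]]
      by (simp add: comult_stage_link[OF Y l] stage_map_link[OF f l])
    show "(stage_map S \<beta> (ar (repl S) f) \<cdot> comult_stage X \<beta>) \<cdot> link S \<alpha> \<beta> X =
        link S \<alpha> \<beta> (SO Y) \<cdot> (stage_map S \<alpha> (ar (repl S) f) \<cdot> comult_stage X \<alpha>)"
      using comp_assoc[OF link_hom[OF X l] \<delta>X[OF F(2)] sSf[OF F(2)]]
        comp_assoc[OF \<delta>X[OF F(1)] link_hom[OF SX l] sSf[OF F(2)]]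
        comp_assoc[OF \<delta>X[OF F(1)] sSf[OF F(1)] link_hom[OF SY l]]
      by (simp add: comult_stage_link[OF X l] stage_map_link[OF Sf l])
  next
    fix \<beta> \<gamma> i a b
    assume s: "is_succ lam \<beta> \<gamma>" and d: "(i, a, b) \<in> sq \<beta> X"
      and IH: "comult_stage Y \<beta> \<cdot> stage_map S \<beta> f =
        stage_map S \<beta> (ar (repl S) f) \<cdot> comult_stage X \<beta>"
    note \<beta> = is_succD[OF s]
    note q = sq_homs[OF d aug_hom[OF X \<beta>(3)]] and c = cell_hom[OF X s d]
    note d' = comult_sq[OF X s \<delta>X[OF \<beta>(3)] aug_comult_stage[OF X \<beta>(3)] d]
    note d'' = sq_map[OF f \<beta>(3) aug_natural[OF f \<beta>(3)] d]
    \<comment> \<open>Both composites send the cell to a cell over \<open>SO Y\<close>, so it is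
      enough to match the names. The attaching maps agree by the induction hypothesis.\<close>
    have "comult_stage Y \<beta> \<cdot> (stage_map S \<beta> f \<cdot> a) =
        stage_map S \<beta> (ar (repl S) f) \<cdot> (comult_stage X \<beta> \<cdot> a)"
      using comp_assoc[OF q(2) sf[OF \<beta>(3)] \<delta>Y[OF \<beta>(3)]]
        comp_assoc[OF q(2) \<delta>X[OF \<beta>(3)] sSf[OF \<beta>(3)]] IH by simp
    \<comment> \<open>The third entries agree because \<open>ar (repl S) f\<close> restricts to
      \<open>stage_map S \<gamma> f\<close>, which carries the cell of a square to the cell of its
      image.\<close>
    moreover have "incl S \<gamma> Y \<cdot> cell S \<beta> Y (i, stage_map S \<beta> f \<cdot> a, f \<cdot> b) =
        ar (repl S) f \<cdot> (incl S \<gamma> X \<cdot> cell S \<beta> X (i, a, b))"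
      using comp_assoc[OF c incl_hom[OF X \<beta>(4)] Sf]
        comp_assoc[OF c sf[OF \<beta>(4)] incl_hom[OF Y \<beta>(4)]]
      by (simp add: stage_map_cell[OF f s d] repl_incl[OF f \<beta>(4)])
    ultimately show "(comult_stage Y \<gamma> \<cdot> stage_map S \<gamma> f) \<cdot> cell S \<beta> X (i, a, b) =
        (stage_map S \<gamma> (ar (repl S) f) \<cdot> comult_stage X \<gamma>) \<cdot> cell S \<beta> X (i, a, b)"
      using comp_assoc[OF c sf[OF \<beta>(4)] \<delta>Y[OF \<beta>(4)]] comp_assoc[OF c \<delta>X[OF \<beta>(4)] sSf[OF \<beta>(4)]]
      by (simp add: stage_map_cell[OF f s d] comult_stage_cell[OF X s d]
          stage_map_cell[OF Sf s d'] comult_stage_cell[OF Y s d''])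
  qed (use assms comp_hom sf sSf \<delta>X \<delta>Y in blast)+
qed

lemma comult_natural:
  assumes f: "f \<in> homs C X Y"
  shows "comult Y \<cdot> ar (repl S) f = ar (repl S) (ar (repl S) f) \<cdot> comult X"
proof -
  note X = hom_obj(1)[OF f] and Y = hom_obj(2)[OF f]
  note SX = repl_obj[OF X] and SY = repl_obj[OF Y] and Sf = repl_hom[OF f]
  show ?thesis
  proof (rule repl_eqI[OF X comp_hom[OF Sf comult_hom[OF Y]]
        comp_hom[OF comult_hom[OF X] repl_hom[OF Sf]]])
    fix \<beta> assume \<beta>: "\<beta> \<in> Field lam"
    show "(comult Y \<cdot> ar (repl S) f) \<cdot> incl S \<beta> X =
        (ar (repl S) (ar (repl S) f) \<cdot> comult X) \<cdot> incl S \<beta> X"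
      using comp_assoc[OF incl_hom[OF X \<beta>] Sf comult_hom[OF Y]]
        comp_assoc[OF stage_map_hom[OF f \<beta>] incl_hom[OF Y \<beta>] comult_hom[OF Y]]
        comp_assoc[OF stage_map_hom[OF f \<beta>] comult_stage_hom[OF Y \<beta>] incl_hom[OF SY \<beta>]]
        comp_assoc[OF incl_hom[OF X \<beta>] comult_hom[OF X] repl_hom[OF Sf]]
        comp_assoc[OF comult_stage_hom[OF X \<beta>] incl_hom[OF SX \<beta>] repl_hom[OF Sf]]
        comp_assoc[OF comult_stage_hom[OF X \<beta>] stage_map_hom[OF Sf \<beta>] incl_hom[OF SY \<beta>]]
      by (simp add: repl_incl[OF f \<beta>] repl_incl[OF Sf \<beta>] comult_incl[OF X \<beta>]
          comult_incl[OF Y \<beta>] comult_stage_natural[OF f \<beta>])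
  qed
qed

section \<open>Coassociativity of the comultiplication\<close>

lemma comult_stage_coassoc:
  assumes X: "X \<in> Obj C" and "\<beta> \<in> Field lam"
  shows "stage_map S \<beta> (comult X) \<cdot> comult_stage X \<beta> =
    comult_stage (SO X) \<beta> \<cdot> comult_stage X \<beta>"
proof -
  note SX = repl_obj[OF X]
  note SSX = repl_obj[OF SX] and \<Delta> = comult_hom[OF X]
  note \<delta> = comult_stage_hom[OF X] and \<delta>S = comult_stage_hom[OF SX] and sm = stage_map_hom[OF \<Delta>]
  show ?thesis
  proof (rule stage_eqI[OF X, where T = "\<lambda>\<beta>. stage S \<beta> (SO (SO X))"
        and \<tau> = "\<lambda>\<alpha> \<beta>. link S \<alpha> \<beta> (SO (SO X))"])
    fix \<alpha> \<beta> assume l: "(\<alpha>, \<beta>) \<in> lam"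
    note F = lam_field[OF l]
    show "(stage_map S \<beta> (comult X) \<cdot> comult_stage X \<beta>) \<cdot> link S \<alpha> \<beta> X =
        link S \<alpha> \<beta> (SO (SO X)) \<cdot> (stage_map S \<alpha> (comult X) \<cdot> comult_stage X \<alpha>)"
      using comp_assoc[OF link_hom[OF X l] \<delta>[OF F(2)] sm[OF F(2)]]
        comp_assoc[OF \<delta>[OF F(1)] link_hom[OF SX l] sm[OF F(2)]]
        comp_assoc[OF \<delta>[OF F(1)] sm[OF F(1)] link_hom[OF SSX l]]
      by (simp add: comult_stage_link[OF X l] stage_map_link[OF \<Delta> l])
    show "(comult_stage (SO X) \<beta> \<cdot> comult_stage X \<beta>) \<cdot> link S \<alpha> \<beta> X =
        link S \<alpha> \<beta> (SO (SO X)) \<cdot> (comult_stage (SO X) \<alpha> \<cdot> comult_stage X \<alpha>)"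
      using comp_assoc[OF link_hom[OF X l] \<delta>[OF F(2)] \<delta>S[OF F(2)]]
        comp_assoc[OF \<delta>[OF F(1)] link_hom[OF SX l] \<delta>S[OF F(2)]]
        comp_assoc[OF \<delta>[OF F(1)] \<delta>S[OF F(1)] link_hom[OF SSX l]]
      by (simp add: comult_stage_link[OF X l] comult_stage_link[OF SX l])
  next
    fix \<beta> \<gamma> i a b
    assume s: "is_succ lam \<beta> \<gamma>" and d: "(i, a, b) \<in> sq \<beta> X"
      and IH: "stage_map S \<beta> (comult X) \<cdot> comult_stage X \<beta> =
        comult_stage (SO X) \<beta> \<cdot> comult_stage X \<beta>"
    note \<beta> = is_succD[OF s]
    note q = sq_homs[OF d aug_hom[OF X \<beta>(3)]] and c = cell_hom[OF X s d]
    note d' = comult_sq[OF X s \<delta>[OF \<beta>(3)] aug_comult_stage[OF X \<beta>(3)] d]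
    \<comment> \<open>Again two names of cells are compared, now over \<open>SO (SO X)\<close>; the
      induction hypothesis settles the attaching maps.\<close>
    have "stage_map S \<beta> (comult X) \<cdot> (comult_stage X \<beta> \<cdot> a) =
        comult_stage (SO X) \<beta> \<cdot> (comult_stage X \<beta> \<cdot> a)"
      using comp_assoc[OF q(2) \<delta>[OF \<beta>(3)] sm[OF \<beta>(3)]]
        comp_assoc[OF q(2) \<delta>[OF \<beta>(3)] \<delta>S[OF \<beta>(3)]] IH by simp
    \<comment> \<open>On the left the third entry is composed with the whole map
      \<open>comult X\<close>; on the right it is the inclusion of the new cell over
      \<open>SO X\<close>. They coincide because \<open>comult X\<close> restricts to
      \<open>comult_stage X \<gamma>\<close>, whose value on the original cell is that new
      cell.\<close>
    moreover have "comult X \<cdot> (incl S \<gamma> X \<cdot> cell S \<beta> X (i, a, b)) = incl S \<gamma> (SO X) \<cdot>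
        cell S \<beta> (SO X) (i, comult_stage X \<beta> \<cdot> a, incl S \<gamma> X \<cdot> cell S \<beta> X (i, a, b))"
      using comp_assoc[OF c incl_hom[OF X \<beta>(4)] \<Delta>]
        comp_assoc[OF c \<delta>[OF \<beta>(4)] incl_hom[OF SX \<beta>(4)]]
      by (simp add: comult_stage_cell[OF X s d] comult_incl[OF X \<beta>(4)])
    ultimately show "(stage_map S \<gamma> (comult X) \<cdot> comult_stage X \<gamma>) \<cdot> cell S \<beta> X (i, a, b) =
        (comult_stage (SO X) \<gamma> \<cdot> comult_stage X \<gamma>) \<cdot> cell S \<beta> X (i, a, b)"
      using comp_assoc[OF c \<delta>[OF \<beta>(4)] sm[OF \<beta>(4)]] comp_assoc[OF c \<delta>[OF \<beta>(4)] \<delta>S[OF \<beta>(4)]]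
      by (simp add: comult_stage_cell[OF X s d] comult_stage_cell[OF SX s d']
          stage_map_cell[OF \<Delta> s d'])
  qed (use assms comp_hom \<delta> \<delta>S sm in blast)+
qed

lemma comult_coassoc:
  assumes X: "X \<in> Obj C"
  shows "ar (repl S) (comult X) \<cdot> comult X = comult (SO X) \<cdot> comult X"
proof -
  note SX = repl_obj[OF X]
  note SSX = repl_obj[OF SX] and \<Delta> = comult_hom[OF X] and \<Delta>S = comult_hom[OF SX]
  show ?thesis
  proof (rule repl_eqI[OF X comp_hom[OF \<Delta> repl_hom[OF \<Delta>]] comp_hom[OF \<Delta> \<Delta>S]])
    fix \<beta> assume \<beta>: "\<beta> \<in> Field lam"
    note \<delta> = comult_stage_hom[OF X \<beta>]
    show "(ar (repl S) (comult X) \<cdot> comult X) \<cdot> incl S \<beta> X =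
        (comult (SO X) \<cdot> comult X) \<cdot> incl S \<beta> X"
      using comp_assoc[OF incl_hom[OF X \<beta>] \<Delta> repl_hom[OF \<Delta>]]
        comp_assoc[OF \<delta> incl_hom[OF SX \<beta>] repl_hom[OF \<Delta>]]
        comp_assoc[OF \<delta> stage_map_hom[OF \<Delta> \<beta>] incl_hom[OF SSX \<beta>]]
        comp_assoc[OF incl_hom[OF X \<beta>] \<Delta> \<Delta>S]
        comp_assoc[OF \<delta> incl_hom[OF SX \<beta>] \<Delta>S]
        comp_assoc[OF \<delta> comult_stage_hom[OF SX \<beta>] incl_hom[OF SSX \<beta>]]
      by (simp add: comult_incl[OF X \<beta>] comult_incl[OF SX \<beta>] repl_incl[OF \<Delta> \<beta>]
          comult_stage_coassoc[OF X \<beta>])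
  qed
qed

lemma comult_cotriple: "cotriple C (repl S) (counit S) comult"
proof -
  have "is_functor C C id_func"
    using category unfolding is_functor_def by (simp add: id_func_def)
  moreover have "is_functor C C (comp_func (repl S) (repl S))"
    using repl_functor unfolding is_functor_def comp_func_def
    by (simp del: split_paired_All) metis
  ultimately show ?thesis
    unfolding cotriple_def nat_trans_def
    using repl_functor counit_hom counit_natural comult_hom comult_natural counit_comult
      repl_counit_comult comult_coassoc
    by (simp add: id_func_def comp_func_def)
qed

end

theorem mainTheorem1:
  fixes M :: "('o, 'm) cat"
    and Weq Cof Fib :: "'m set"
    and zero :: 'o
    and I :: "'i set"
    and \<phi> :: "'i \<Rightarrow> 'm"
    and lam :: "'u rel"
    and S :: "('o, 'm, 'i, 'u) soa"
  assumes "universe TYPE('u)"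
    and "model_category TYPE('u) M Weq Cof Fib"
    and "is_initial M zero"
    and "small TYPE('u) I"
    and "\<forall>i \<in> I. \<phi> i \<in> Cof"
    and "{f. \<exists>g. rel_cell_complex TYPE('u) M I \<phi> g \<and> retract_of M f g} = Cof"
    and "regular_ordinal TYPE('u) lam"
    and "\<forall>i \<in> I. small_relative TYPE('u) M lam Cof (Dom M (\<phi> i))"
    and "small_object_argument M zero I \<phi> lam S"
  shows "\<exists>\<Delta>. cotriple M (repl S) (counit S) \<Delta>"
proof -
  interpret small_object_functor M zero I \<phi> lam S
  proof
    show "category M"
      using assms(2) by (simp add: model_category_def)
    show "is_initial M zero" "small_object_argument M zero I \<phi> lam S"
      by (fact assms)+
    have "Cof \<subseteq> Arr M"
      using assms(2) by (simp add: model_category_def)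
    then show "\<phi> i \<in> Arr M" if "i \<in> I" for i
      using assms(5) that by blast
    show "Well_order lam"
      using assms(7) by (simp add: regular_ordinal_def small_ordinal_def)
  qed
  show ?thesis
    using comult_cotriple by blast
qed

end
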